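(* Let $c,c'\in\mathbb R$ with $|c|<1$, $|c'|<1$ and $c\neq c'$. Then the necklace Poisson structures $\pi_c$ and $\pi_{c'}$ on $S^2$ are nontrivial deformations of each other, in the sense that the class of $\pi_{c'}-\pi_c$ in $H^2_{\pi_c}(S^2)$ is nonzero (and likewise with the roles of $c$ and $c'$ interchanged).
   Context: $S^2\subset\mathbb R^3$ is the unit sphere with coordinates $(x_1,x_2,x_3)$, and $\pi$ is the standard rotation-invariant symplectic Poisson structure: in the stereographic coordinate $w=x+iy$ with $x_3=\frac{1-x^2-y^2}{1+x^2+y^2}$, $\pi=\frac14(1+x^2+y^2)^2\partial_x\wedge\partial_y$ and $\pi_c=(c-x_3)\pi=\frac14(1+x^2+y^2)\big((c+1)(x^2+y^2)+c-1\big)\partial_x\wedge\partial_y$. For $|c|<1$ these are called necklace structures. The Poisson cohomology $H^\star_{\pi_c}(S^2)$ is the cohomology of the complex of smooth multivector fields with differential $d_{\pi_c}=[\pi_c,\cdot]$ (Schouten bracket); $H^2_{\pi_c}$ classifies nontrivial infinitesimal deformations of $\pi_c$. *)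

theory Defs
  imports "HOL-Analysis.Analysis" "HOL-Combinatorics.Permutations"
begin

section \<open>Smooth functions on the sphere\<close>

text \<open>A function is smooth if all of its iterated directional derivatives, in arbitrary directions,
  exist everywhere and are Frechet differentiable.\<close>

primrec Ck :: "nat \<Rightarrow> ('a::real_normed_vector \<Rightarrow> real) \<Rightarrow> bool" where
  "Ck 0 f \<longleftrightarrow> continuous_on UNIV f"
| "Ck (Suc k) f \<longleftrightarrow>
    (\<forall>x. f differentiable (at x)) \<and> (\<forall>v. Ck k (\<lambda>x. frechet_derivative f (at x) v))"

definition smooth :: "('a::real_normed_vector \<Rightarrow> real) \<Rightarrow> bool" where
  "smooth f \<longleftrightarrow> (\<forall>k. Ck k f)"

typedef S2 = "sphere (0 :: real^3) 1"
  morphisms coords Abs_S2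
  by (rule exI[of _ "axis 1 1"]) (simp add: dist_norm)

setup_lifting type_definition_S2

text \<open>The smooth structure of the sphere is given by two charts. The first is the inverse of the
  stereographic coordinate \<open>w\<close> centred at the pole \<open>x\<^sub>3 = 1\<close>, which misses only the pole
  \<open>x\<^sub>3 = - 1\<close>; the second is centred at \<open>x\<^sub>3 = - 1\<close>, and its coordinate is \<open>u = 1 / w\<close>
  (lemma \<open>stereoN_inverse\<close> below).\<close>

lemma sphere_vector3:
  "(vector [a, b, c] :: real^3) \<in> sphere 0 1 \<longleftrightarrow> a\<^sup>2 + b\<^sup>2 + c\<^sup>2 = 1"
  by (simp add: norm_vec_def L2_set_def sum_3)

lemma stereo_identity:
  fixes x y :: real
  shows "(2 * x / (1 + (x\<^sup>2 + y\<^sup>2)))\<^sup>2 + (2 * y / (1 + (x\<^sup>2 + y\<^sup>2)))\<^sup>2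
    + ((1 - (x\<^sup>2 + y\<^sup>2)) / (1 + (x\<^sup>2 + y\<^sup>2)))\<^sup>2 = 1"
proof -
  have "1 + (x\<^sup>2 + y\<^sup>2) > 0" by (smt (verit) sum_power2_ge_zero)
  then have "1 + (x\<^sup>2 + y\<^sup>2) \<noteq> 0" by simp
  then show ?thesis
    by (simp add: power_divide add_divide_distrib[symmetric]) (simp add: power2_eq_square algebra_simps)
qed

lift_definition stereoN :: "complex \<Rightarrow> S2" is
  "\<lambda>w. vector [2 * Re w / (1 + (cmod w)\<^sup>2), 2 * Im w / (1 + (cmod w)\<^sup>2),
               (1 - (cmod w)\<^sup>2) / (1 + (cmod w)\<^sup>2)]"
  using stereo_identity unfolding sphere_vector3 cmod_power2 by blast

lift_definition stereoS :: "complex \<Rightarrow> S2" is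
  "\<lambda>u. vector [2 * Re u / (1 + (cmod u)\<^sup>2), - (2 * Im u / (1 + (cmod u)\<^sup>2)),
               - ((1 - (cmod u)\<^sup>2) / (1 + (cmod u)\<^sup>2))]"
  using stereo_identity unfolding sphere_vector3 cmod_power2 power2_minus by blast


lemma stereoN_nth:
  "coords (stereoN w) $ 1 = 2 * Re w / (1 + (cmod w)\<^sup>2)"
  "coords (stereoN w) $ 2 = 2 * Im w / (1 + (cmod w)\<^sup>2)"
  "coords (stereoN w) $ 3 = (1 - (cmod w)\<^sup>2) / (1 + (cmod w)\<^sup>2)"
  by (transfer, simp)+

lemma stereoS_nth:
  "coords (stereoS u) $ 1 = 2 * Re u / (1 + (cmod u)\<^sup>2)"
  "coords (stereoS u) $ 2 = - (2 * Im u / (1 + (cmod u)\<^sup>2))"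
  "coords (stereoS u) $ 3 = - ((1 - (cmod u)\<^sup>2) / (1 + (cmod u)\<^sup>2))"
  by (transfer, simp)+

lemma S2_eqI:
  assumes "coords p $ 1 = coords q $ 1" "coords p $ 2 = coords q $ 2" "coords p $ 3 = coords q $ 3"
  shows "p = q"
proof -
  have "coords p = coords q" using assms by (simp add: vec_eq_iff forall_3)
  then show ?thesis by (simp add: coords_inject)
qed

lemma pos1 [simp]: "1 + (cmod w)\<^sup>2 > 0" "1 + (cmod w)\<^sup>2 \<noteq> 0"
proof -
  show "1 + (cmod w)\<^sup>2 > 0" by (smt (verit) zero_le_power2)
  then show "1 + (cmod w)\<^sup>2 \<noteq> 0" by simp
qed

lemma inj_stereoN: "inj stereoN"
proof (rule injI)
  fix w z assume eq: "stereoN w = stereoN z"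
  have *: "1 + (1 - (cmod w)\<^sup>2) / (1 + (cmod w)\<^sup>2) = 2 / (1 + (cmod w)\<^sup>2)" for w
    by (simp add: field_simps)
  have "2 / (1 + (cmod w)\<^sup>2) = 2 / (1 + (cmod z)\<^sup>2)"
    using arg_cong[OF eq, of "\<lambda>p. 1 + coords p $ 3"] unfolding stereoN_nth * .
  then have e: "1 + (cmod w)\<^sup>2 = 1 + (cmod z)\<^sup>2" by (simp add: frac_eq_eq)
  show "w = z"
    using arg_cong[OF eq, of "\<lambda>p. coords p $ 1"] arg_cong[OF eq, of "\<lambda>p. coords p $ 2"]
    unfolding stereoN_nth e by (simp add: complex_eq_iff)
qed

lemma inj_stereoS: "inj stereoS"
proof (rule injI)
  fix w z assume eq: "stereoS w = stereoS z"
  have "stereoN w = stereoN z"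
    using arg_cong[OF eq, of "\<lambda>p. coords p $ 1"] arg_cong[OF eq, of "\<lambda>p. coords p $ 2"]
      arg_cong[OF eq, of "\<lambda>p. coords p $ 3"]
    unfolding stereoS_nth neg_equal_iff_equal by (intro S2_eqI) (simp_all only: stereoN_nth)
  then show "w = z" using inj_stereoN by (simp add: inj_eq)
qed

lemma stereoN_inverse:
  assumes "u \<noteq> 0"
  shows "stereoN (inverse u) = stereoS u"
proof -
  have n: "(cmod u)\<^sup>2 \<noteq> 0" using assms by simp
  have r: "Re (inverse u) = Re u / (cmod u)\<^sup>2" "Im (inverse u) = - Im u / (cmod u)\<^sup>2"
    by (simp_all add: cmod_power2)
  have m: "(cmod (inverse u))\<^sup>2 = 1 / (cmod u)\<^sup>2"
    unfolding norm_inverse power_inverse by (rule inverse_eq_divide)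
  have d: "1 + 1 / (cmod u)\<^sup>2 = (1 + (cmod u)\<^sup>2) / (cmod u)\<^sup>2"
      "1 - 1 / (cmod u)\<^sup>2 = - ((1 - (cmod u)\<^sup>2) / (cmod u)\<^sup>2)"
    using n by (simp_all add: field_simps)
  have q: "- ((1 - (cmod u)\<^sup>2) / (cmod u)\<^sup>2) / ((1 + (cmod u)\<^sup>2) / (cmod u)\<^sup>2)
      = - ((1 - (cmod u)\<^sup>2) / (1 + (cmod u)\<^sup>2))"
    unfolding minus_divide_left[symmetric] using n by simp
  show ?thesis
    by (rule S2_eqI; unfold stereoN_nth stereoS_nth r m d q) (use n in \<open>simp_all\<close>)
qed

lemma S2_cases:
  obtains (N) w where "p = stereoN w" | (S) "p = stereoS 0"
proof -
  let ?x = "coords p $ 1" and ?y = "coords p $ 2" and ?z = "coords p $ 3"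
  have "coords p \<in> sphere 0 1" by (rule coords)
  then have s: "?x\<^sup>2 + ?y\<^sup>2 + ?z\<^sup>2 = 1" by (simp add: norm_vec_def L2_set_def sum_3)
  show thesis
  proof (cases "?z = -1")
    case True
    then have "?x\<^sup>2 + ?y\<^sup>2 = 0" using s by simp
    then have "?x = 0" "?y = 0" by (simp_all add: sum_power2_eq_zero_iff)
    then have "p = stereoS 0" using True by (intro S2_eqI) (simp_all add: stereoS_nth)
    then show thesis by (rule S)
  next
    case False
    then have z: "1 + ?z \<noteq> 0" by simp
    define w where "w = Complex (?x / (1 + ?z)) (?y / (1 + ?z))"
    have "(cmod w)\<^sup>2 = (?x\<^sup>2 + ?y\<^sup>2) / (1 + ?z)\<^sup>2"
      by (simp add: w_def cmod_power2 power_divide add_divide_distrib)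
    also have "?x\<^sup>2 + ?y\<^sup>2 = (1 - ?z) * (1 + ?z)" using s by (simp add: power2_eq_square algebra_simps)
    finally have m: "(cmod w)\<^sup>2 = (1 - ?z) / (1 + ?z)" using z by (simp add: power2_eq_square)
    have d: "1 + (cmod w)\<^sup>2 = 2 / (1 + ?z)" "1 - (cmod w)\<^sup>2 = 2 * ?z / (1 + ?z)"
      unfolding m using z by (simp_all add: field_simps)
    have "p = stereoN w"
      by (rule S2_eqI; unfold stereoN_nth d) (use z in \<open>simp_all add: w_def\<close>)
    then show thesis by (rule N)
  qed
qed

subsection \<open>Closure properties of smooth functions\<close>

lemma Ck_mono: "Ck (Suc k) f \<Longrightarrow> Ck k f"
proof (induction k arbitrary: f)
  case 0
  then show ?case
    by (auto simp: continuous_on_eq_continuous_at intro!: differentiable_imp_continuous_within)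
next
  case (Suc k)
  then show ?case by (metis Ck.simps(2))
qed

lemma Ck_SucD: "Ck (Suc k) f \<Longrightarrow> f differentiable (at x)"
  "Ck (Suc k) f \<Longrightarrow> Ck k (\<lambda>x. frechet_derivative f (at x) v)"
  by auto

lemma Ck_SucI:
  assumes "\<And>x. (f has_derivative f' x) (at x)" "\<And>v. Ck k (\<lambda>x. f' x v)"
  shows "Ck (Suc k) f"
proof -
  have "frechet_derivative f (at x) = f' x" for x
    by (rule frechet_derivative_at[OF assms(1), symmetric])
  then show ?thesis using assms by (auto simp: differentiable_def)
qed

lemma Ck_const: "Ck k (\<lambda>x. c)"
proof (induction k arbitrary: c)
  case (Suc k)
  show ?case by (rule Ck_SucI[where f'="\<lambda>x v. 0"]) (use Suc in auto)
qed simp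

lemma Ck_linear: "bounded_linear f \<Longrightarrow> Ck k f"
proof (cases k)
  case 0
  assume "bounded_linear f"
  then show ?thesis using 0 by (simp add: linear_continuous_on)
next
  case (Suc n)
  assume "bounded_linear f"
  then show ?thesis unfolding Suc
    by (intro Ck_SucI[where f'="\<lambda>x v. f v"]) (auto intro: Ck_const bounded_linear_imp_has_derivative)
qed

lemma Ck_has_derivative:
  "Ck (Suc k) f \<Longrightarrow> (f has_derivative frechet_derivative f (at x)) (at x)"
  by (simp add: frechet_derivative_works)

lemma Ck_add: "Ck k f \<Longrightarrow> Ck k g \<Longrightarrow> Ck k (\<lambda>x. f x + g x)"
proof (induction k arbitrary: f g)
  case 0
  then show ?case by (auto intro: continuous_on_add)
next
  case (Suc k)
  show ?case
    by (rule Ck_SucI, rule has_derivative_add[OF Ck_has_derivative Ck_has_derivative])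
       (use Suc in \<open>auto simp del: Ck.simps intro: Ck_SucD\<close>)
qed

lemma Ck_mult: "Ck k f \<Longrightarrow> Ck k g \<Longrightarrow> Ck k (\<lambda>x. f x * g x)"
proof (induction k arbitrary: f g)
  case 0
  then show ?case by (auto intro: continuous_on_mult)
next
  case (Suc k)
  show ?case
    by (rule Ck_SucI, rule has_derivative_mult[OF Ck_has_derivative Ck_has_derivative])
       (use Suc in \<open>auto simp del: Ck.simps intro!: Ck_add Suc.IH intro: Ck_SucD Ck_mono\<close>)
qed

lemma Ck_inverse: "Ck k f \<Longrightarrow> (\<And>x. f x \<noteq> 0) \<Longrightarrow> Ck k (\<lambda>x. inverse (f x))"
proof (induction k arbitrary: f)
  case 0
  then show ?case by (auto intro: continuous_on_inverse)
next
  case (Suc k)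
  have *: "Ck k (\<lambda>x. inverse (f x))" using Suc by (blast intro: Ck_mono)
  have "((\<lambda>x. inverse (f x)) has_derivative
        (\<lambda>v. (- 1) * (inverse (f x) * frechet_derivative f (at x) v * inverse (f x)))) (at x)" for x
    by (rule derivative_eq_intros Ck_has_derivative[OF Suc.prems(1)] Suc.prems(2) | simp)+
  then show ?case
    by (rule Ck_SucI) (intro Ck_mult Ck_const * Ck_SucD(2)[OF Suc.prems(1)])
qed

lemma smooth_const [intro]: "smooth (\<lambda>x. c)"
  and smooth_linear: "bounded_linear f \<Longrightarrow> smooth f"
  and smooth_add [intro]: "smooth f \<Longrightarrow> smooth g \<Longrightarrow> smooth (\<lambda>x. f x + g x)"
  and smooth_mult [intro]: "smooth f \<Longrightarrow> smooth g \<Longrightarrow> smooth (\<lambda>x. f x * g x)"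
  and smooth_inverse: "smooth f \<Longrightarrow> (\<And>x. f x \<noteq> 0) \<Longrightarrow> smooth (\<lambda>x. inverse (f x))"
  and smooth_differentiable: "smooth f \<Longrightarrow> f differentiable (at x)"
  and smooth_derivative [intro]: "smooth f \<Longrightarrow> smooth (\<lambda>x. frechet_derivative f (at x) v)"
  unfolding smooth_def
  by (auto simp del: Ck.simps intro: Ck_const Ck_linear Ck_add Ck_mult Ck_inverse Ck_SucD)

lemma smooth_uminus [intro]: "smooth f \<Longrightarrow> smooth (\<lambda>x. - f x)"
  using smooth_mult[OF smooth_const[of "-1"], of f] by simp

lemma smooth_diff [intro]: "smooth f \<Longrightarrow> smooth g \<Longrightarrow> smooth (\<lambda>x. f x - g x)"
  using smooth_add[OF _ smooth_uminus, of f g] by simp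

lemma smooth_power [intro]: "smooth f \<Longrightarrow> smooth (\<lambda>x. f x ^ n)"
  by (induction n) auto

lemma smooth_Re [intro]: "smooth Re" and smooth_Im [intro]: "smooth Im"
  by (auto intro: smooth_linear bounded_linear_Re bounded_linear_Im)

lemma smooth_cmod2 [intro]: "smooth (\<lambda>w. (cmod w)\<^sup>2)"
  unfolding cmod_power2 by (intro smooth_add smooth_power smooth_Re smooth_Im)

lemma smooth_stereo_quotient: "smooth f \<Longrightarrow> smooth (\<lambda>w. f w / (1 + (cmod w)\<^sup>2))"
  unfolding divide_inverse
  by (intro smooth_mult smooth_inverse smooth_add smooth_const smooth_cmod2) simp_all

subsection \<open>The algebra of smooth functions on the sphere\<close>

typedef cinf = "{f :: S2 \<Rightarrow> real. smooth (f \<circ> stereoN) \<and> smooth (f \<circ> stereoS)}"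
  morphisms fval Abs_cinf
  by (rule exI[of _ "\<lambda>_. 0"]) (auto simp: comp_def)

setup_lifting type_definition_cinf

instantiation cinf :: "{comm_ring_1, real_algebra_1}"
begin

lift_definition zero_cinf :: cinf is "\<lambda>_. 0" by (auto simp: comp_def)
lift_definition one_cinf :: cinf is "\<lambda>_. 1" by (auto simp: comp_def)
lift_definition plus_cinf :: "cinf \<Rightarrow> cinf \<Rightarrow> cinf" is "\<lambda>f g p. f p + g p" by (auto simp: comp_def)
lift_definition minus_cinf :: "cinf \<Rightarrow> cinf \<Rightarrow> cinf" is "\<lambda>f g p. f p - g p" by (auto simp: comp_def)
lift_definition uminus_cinf :: "cinf \<Rightarrow> cinf" is "\<lambda>f p. - f p" by (auto simp: comp_def)
lift_definition times_cinf :: "cinf \<Rightarrow> cinf \<Rightarrow> cinf" is "\<lambda>f g p. f p * g p" by (auto simp: comp_def)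
lift_definition scaleR_cinf :: "real \<Rightarrow> cinf \<Rightarrow> cinf" is "\<lambda>c f p. c * f p" by (auto simp: comp_def)

instance
  by standard (transfer; auto simp: algebra_simps fun_eq_iff)+

end

lift_definition coord_fun :: "3 \<Rightarrow> cinf" is "\<lambda>i p. coords p $ i"
proof -
  fix i :: 3
  have "\<forall>i::3. smooth (\<lambda>w. coords (stereoN w) $ i) \<and> smooth (\<lambda>u. coords (stereoS u) $ i)"
    unfolding forall_3 stereoN_nth stereoS_nth
    by (intro conjI smooth_stereo_quotient smooth_uminus smooth_mult smooth_diff smooth_const
        smooth_Re smooth_Im smooth_cmod2)
  then show "smooth ((\<lambda>p. coords p $ i) \<circ> stereoN) \<and> smooth ((\<lambda>p. coords p $ i) \<circ> stereoS)"
    by (simp add: comp_def)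
qed

lemma fval_simps [simp]:
  "fval 0 p = 0" "fval 1 p = 1" "fval (f + g) p = fval f p + fval g p"
  "fval (f - g) p = fval f p - fval g p" "fval (- f) p = - fval f p"
  "fval (f * g) p = fval f p * fval g p" "fval (c *\<^sub>R f) p = c * fval f p"
  "fval (coord_fun i) p = coords p $ i"
  by (simp_all add: zero_cinf.rep_eq one_cinf.rep_eq plus_cinf.rep_eq minus_cinf.rep_eq
      uminus_cinf.rep_eq times_cinf.rep_eq scaleR_cinf.rep_eq coord_fun.rep_eq)

lemma fval_of_real [simp]: "fval (of_real c) p = c"
  by (simp add: of_real_def)

lemma cinf_eqI: "(\<And>p. fval f p = fval g p) \<Longrightarrow> f = g"
  by (simp add: fval_inject[symmetric] fun_eq_iff)

section \<open>Multivector fields and the Schouten bracket\<close>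

text \<open>A \<open>k\<close>-vector field on a manifold is an alternating \<open>k\<close>-fold derivation of its algebra of
  smooth functions. It is represented by a function on lists that vanishes on all lists of length
  other than \<open>k\<close>; a \<open>0\<close>-vector field is determined by its value on the empty list.\<close>

definition multiderivation :: "nat \<Rightarrow> ('a::{comm_ring_1,real_algebra_1} list \<Rightarrow> 'a) \<Rightarrow> bool" where
  "multiderivation k P \<longleftrightarrow>
    (\<forall>fs. length fs \<noteq> k \<longrightarrow> P fs = 0) \<and>
    (\<forall>fs i. length fs = k \<and> i < k \<longrightarrow>
       linear (\<lambda>f. P (fs[i := f])) \<and>
       (\<forall>f g. P (fs[i := f * g]) = f * P (fs[i := g]) + g * P (fs[i := f]))) \<and>
    (\<forall>fs i j. length fs = k \<and> i < j \<and> j < k \<and> fs ! i = fs ! j \<longrightarrow> P fs = 0)"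

definition shuffle_perms :: "nat \<Rightarrow> nat \<Rightarrow> (nat \<Rightarrow> nat) set" where
  "shuffle_perms p q = {\<sigma>. \<sigma> permutes {..<p + q} \<and>
     strict_mono_on {..<p} \<sigma> \<and> strict_mono_on {p..<p + q} \<sigma>}"

text \<open>\<open>insertion p q P Q\<close> is the alternating sum over shuffles of
  \<open>P (Q (f\<^bsub>\<sigma> 0\<^esub>, \<dots>, f\<^bsub>\<sigma> (q-1)\<^esub>), f\<^bsub>\<sigma> q\<^esub>, \<dots>)\<close>, and the Schouten bracket is the graded commutator of this
  operation. For \<open>p = 0\<close> the natural-number subtraction \<open>p - 1\<close> is harmless: \<open>P\<close> then vanishes on
  nonempty lists, so the sum is zero, as it should be.\<close>

definition insertion :: "nat \<Rightarrow> nat \<Rightarrow> ('a::comm_ring_1 list \<Rightarrow> 'a) \<Rightarrow> ('a list \<Rightarrow> 'a) \<Rightarrow> 'a list \<Rightarrow> 'a" where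
  "insertion p q P Q fs = (\<Sum>\<sigma>\<in>shuffle_perms q (p - 1). of_int (sign \<sigma>) *
     P (Q (map (\<lambda>i. fs ! \<sigma> i) [0..<q]) # map (\<lambda>i. fs ! \<sigma> i) [q..<q + (p - 1)]))"

definition schouten :: "nat \<Rightarrow> nat \<Rightarrow> ('a::comm_ring_1 list \<Rightarrow> 'a) \<Rightarrow> ('a list \<Rightarrow> 'a) \<Rightarrow> 'a list \<Rightarrow> 'a" where
  "schouten p q P Q fs = (if length fs = p + q - 1
     then insertion p q P Q fs - (-1) ^ ((p - 1) * (q - 1)) * insertion q p Q P fs else 0)"

definition poisson_structure :: "('a::{comm_ring_1,real_algebra_1} list \<Rightarrow> 'a) \<Rightarrow> bool" where
  "poisson_structure \<pi> \<longleftrightarrow> multiderivation 2 \<pi> \<and> schouten 2 2 \<pi> \<pi> = (\<lambda>_. 0)"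

section \<open>Poisson cohomology\<close>

text \<open>The complex \<open>X\<^sup>k \<rightarrow> X\<^sup>k\<^sup>+\<^sup>1\<close>, \<open>P \<mapsto> [\<pi>, P]\<close>. Cohomology is the quotient of cocycles by the
  relation of differing by a coboundary, so a class vanishes if it is the class of \<open>\<lambda>_. 0\<close>.\<close>

definition poisson_d :: "('a::comm_ring_1 list \<Rightarrow> 'a) \<Rightarrow> nat \<Rightarrow> ('a list \<Rightarrow> 'a) \<Rightarrow> 'a list \<Rightarrow> 'a" where
  "poisson_d \<pi> k P = schouten 2 k \<pi> P"

definition cocycles ::
  "('a::{comm_ring_1,real_algebra_1} list \<Rightarrow> 'a) \<Rightarrow> nat \<Rightarrow> ('a list \<Rightarrow> 'a) set" where
  "cocycles \<pi> k = {P. multiderivation k P \<and> poisson_d \<pi> k P = (\<lambda>_. 0)}"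

definition coboundaries ::
  "('a::{comm_ring_1,real_algebra_1} list \<Rightarrow> 'a) \<Rightarrow> nat \<Rightarrow> ('a list \<Rightarrow> 'a) set" where
  "coboundaries \<pi> k =
    (case k of 0 \<Rightarrow> {\<lambda>_. 0} | Suc j \<Rightarrow> poisson_d \<pi> j ` {R. multiderivation j R})"

definition cohomologous ::
  "('a::{comm_ring_1,real_algebra_1} list \<Rightarrow> 'a) \<Rightarrow> nat \<Rightarrow> (('a list \<Rightarrow> 'a) \<times> ('a list \<Rightarrow> 'a)) set" where
  "cohomologous \<pi> k =
    {(P, Q). P \<in> cocycles \<pi> k \<and> Q \<in> cocycles \<pi> k \<and> P - Q \<in> coboundaries \<pi> k}"

definition poisson_cohomology ::
  "('a::{comm_ring_1,real_algebra_1} list \<Rightarrow> 'a) \<Rightarrow> nat \<Rightarrow> ('a list \<Rightarrow> 'a) set set" where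
  "poisson_cohomology \<pi> k = cocycles \<pi> k // cohomologous \<pi> k"

definition cohomology_class ::
  "('a::{comm_ring_1,real_algebra_1} list \<Rightarrow> 'a) \<Rightarrow> nat \<Rightarrow> ('a list \<Rightarrow> 'a) \<Rightarrow> ('a list \<Rightarrow> 'a) set" where
  "cohomology_class \<pi> k P = cohomologous \<pi> k `` {P}"

section \<open>Necklace structures\<close>

text \<open>\<open>jac F G\<close> is \<open>(\<partial>\<^sub>x \<and> \<partial>\<^sub>y)(dF, dG)\<close> for the real coordinates \<open>w = x + \<i>y\<close>.\<close>

definition jac :: "(complex \<Rightarrow> real) \<Rightarrow> (complex \<Rightarrow> real) \<Rightarrow> complex \<Rightarrow> real" where
  "jac F G w =
     frechet_derivative F (at w) 1 * frechet_derivative G (at w) \<i>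
   - frechet_derivative F (at w) \<i> * frechet_derivative G (at w) 1"

lemma smooth_jac: "smooth F \<Longrightarrow> smooth G \<Longrightarrow> smooth (jac F G)"
  unfolding jac_def by (intro smooth_diff smooth_mult smooth_derivative)

lemma jac_compose:
  assumes F: "F differentiable (at (\<tau> z))" and G: "G differentiable (at (\<tau> z))"
    and \<tau>: "(\<tau> has_field_derivative d) (at z)"
  shows "jac (F \<circ> \<tau>) (G \<circ> \<tau>) z = (cmod d)\<^sup>2 * jac F G (\<tau> z)"
proof -
  have comp: "frechet_derivative (H \<circ> \<tau>) (at z) = (\<lambda>v. frechet_derivative H (at (\<tau> z)) (d * v))"
    if "H differentiable (at (\<tau> z))" for H :: "complex \<Rightarrow> real"
  proof -
    have "(H has_derivative frechet_derivative H (at (\<tau> z))) (at (\<tau> z))"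
      using that frechet_derivative_works by blast
    then have "(H \<circ> \<tau> has_derivative frechet_derivative H (at (\<tau> z)) \<circ> (\<lambda>v. d * v)) (at z)"
      using \<tau> unfolding has_field_derivative_def by (intro diff_chain_at) auto
    from frechet_derivative_at[OF this] show ?thesis by (simp add: comp_def)
  qed
  have lin: "L v = Re v * L 1 + Im v * L \<i>" if "linear L" for L :: "complex \<Rightarrow> real" and v
  proof -
    have "v = Re v *\<^sub>R 1 + Im v *\<^sub>R \<i>" by (simp add: complex_eq_iff)
    then have "L v = L (Re v *\<^sub>R 1 + Im v *\<^sub>R \<i>)" by (rule arg_cong)
    also have "\<dots> = Re v * L 1 + Im v * L \<i>"
      using that by (simp add: linear_add linear_scale)
    finally show ?thesis .
  qed
  have *: "frechet_derivative H (at (\<tau> z)) v = Re v * frechet_derivative H (at (\<tau> z)) 1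
      + Im v * frechet_derivative H (at (\<tau> z)) \<i>"
    if "H differentiable (at (\<tau> z))" for H :: "complex \<Rightarrow> real" and v
    using that by (intro lin linear_frechet_derivative)
  show ?thesis
    unfolding jac_def comp[OF F] comp[OF G] *[OF F, of "d * _"] *[OF G, of "d * _"]
    unfolding cmod_power2 by (simp add: power2_eq_square algebra_simps)
qed

definition chart_bracket :: "(complex \<Rightarrow> S2) \<Rightarrow> (S2 \<Rightarrow> real) \<Rightarrow> (S2 \<Rightarrow> real) \<Rightarrow> complex \<Rightarrow> real" where
  "chart_bracket \<phi> f g w = 1/4 * (1 + (cmod w)\<^sup>2)\<^sup>2 * jac (f \<circ> \<phi>) (g \<circ> \<phi>) w"

lemma smooth_chart_bracket:
  "smooth (f \<circ> \<phi>) \<Longrightarrow> smooth (g \<circ> \<phi>) \<Longrightarrow> smooth (chart_bracket \<phi> f g)"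
  unfolding chart_bracket_def 
  by (intro smooth_mult smooth_power smooth_add smooth_const smooth_cmod2 smooth_jac)

lemma chart_bracket_transition:
  assumes f: "smooth (f \<circ> stereoN)" and g: "smooth (g \<circ> stereoN)" and u: "u \<noteq> 0"
  shows "chart_bracket stereoS f g u = chart_bracket stereoN f g (inverse u)"
proof -
  have d: "(inverse has_field_derivative - (inverse u ^ 2)) (at u)"
    using DERIV_inverse[OF u] by (simp add: numeral_2_eq_2)
  have cong: "frechet_derivative (h \<circ> stereoS) (at u) = frechet_derivative ((h \<circ> stereoN) \<circ> inverse) (at u)"
    if "smooth (h \<circ> stereoN)" for h :: "S2 \<Rightarrow> real"
  proof -
    have "((h \<circ> stereoN) \<circ> inverse) differentiable (at u)"
      using d that unfolding has_field_derivative_def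
      by (intro differentiable_chain_at smooth_differentiable) (auto simp: differentiable_def)
    then have "((h \<circ> stereoN) \<circ> inverse has_derivative
        frechet_derivative ((h \<circ> stereoN) \<circ> inverse) (at u)) (at u)"
      using frechet_derivative_works by blast
    then have "(h \<circ> stereoS has_derivative
        frechet_derivative ((h \<circ> stereoN) \<circ> inverse) (at u)) (at u)"
    proof (rule has_derivative_transform_within_open[of _ _ _ _ "- {0}"])
      show "((h \<circ> stereoN) \<circ> inverse) z = (h \<circ> stereoS) z" if "z \<in> - {0}" for z
        using that by (simp add: stereoN_inverse)
    qed (use u in auto)
    from frechet_derivative_at[OF this] show ?thesis by simp
  qed
  have "jac (f \<circ> stereoS) (g \<circ> stereoS) u
      = jac ((f \<circ> stereoN) \<circ> inverse) ((g \<circ> stereoN) \<circ> inverse) u"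
    unfolding jac_def cong[OF f] cong[OF g] ..
  also have "\<dots> = (cmod (- (inverse u ^ 2)))\<^sup>2 * jac (f \<circ> stereoN) (g \<circ> stereoN) (inverse u)"
    by (rule jac_compose[OF _ _ d]) (use f g in \<open>auto intro: smooth_differentiable\<close>)
  finally have j: "jac (f \<circ> stereoS) (g \<circ> stereoS) u
     = (inverse (cmod u) ^ 2)\<^sup>2 * jac (f \<circ> stereoN) (g \<circ> stereoN) (inverse u)"
    by (simp add: norm_power norm_inverse)
  have "1 + (cmod (inverse u))\<^sup>2 = (1 + (cmod u)\<^sup>2) * inverse (cmod u) ^ 2"
    using u unfolding norm_inverse by (simp add: field_simps)
  then show ?thesis
    unfolding chart_bracket_def j by (simp add: power_mult_distrib)
qed

lemma stereoS_0_notin: "stereoS 0 \<noteq> stereoN w"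
proof
  assume "stereoS 0 = stereoN w"
  from arg_cong[OF this, of "\<lambda>p. coords p $ 3"] show False
    unfolding stereoN_nth stereoS_nth by (simp add: field_simps)
qed

text \<open>The expression \<open>1/4 (1 + x\<^sup>2 + y\<^sup>2)\<^sup>2 \<partial>\<^sub>x \<and> \<partial>\<^sub>y\<close> is invariant under \<open>w \<mapsto> 1/w\<close> (lemma
  \<open>chart_bracket_transition\<close>), so using it in both charts gives the unique smooth extension of the
  bivector field to the pole that the coordinate \<open>w\<close> misses.\<close>

lift_definition std_bracket :: "cinf \<Rightarrow> cinf \<Rightarrow> cinf" is
  "\<lambda>f g p. if p \<in> range stereoN then chart_bracket stereoN f g (inv stereoN p)
           else chart_bracket stereoS f g (inv stereoS p)"
proof -
  fix f g :: "S2 \<Rightarrow> real"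
  assume fg: "smooth (f \<circ> stereoN) \<and> smooth (f \<circ> stereoS)" "smooth (g \<circ> stereoN) \<and> smooth (g \<circ> stereoS)"
  let ?T = "\<lambda>p. if p \<in> range stereoN then chart_bracket stereoN f g (inv stereoN p)
           else chart_bracket stereoS f g (inv stereoS p)"
  have N: "?T \<circ> stereoN = chart_bracket stereoN f g"
    by (auto simp: fun_eq_iff inj_stereoN inv_f_f)
  have "?T (stereoS u) = chart_bracket stereoS f g u" for u
  proof (cases "u = 0")
    case True
    then show ?thesis using stereoS_0_notin by (auto simp: inj_stereoS inv_f_f)
  next
    case False
    have "?T (stereoS u) = ?T (stereoN (inverse u))" using False by (simp add: stereoN_inverse)
    also have "\<dots> = chart_bracket stereoN f g (inverse u)" using N by (simp add: fun_eq_iff)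
    also have "\<dots> = chart_bracket stereoS f g u" using fg False by (simp add: chart_bracket_transition)
    finally show ?thesis .
  qed
  then have S: "?T \<circ> stereoS = chart_bracket stereoS f g" by (simp add: fun_eq_iff)
  show "smooth (?T \<circ> stereoN) \<and> smooth (?T \<circ> stereoS)"
    unfolding N S using fg by (auto intro: smooth_chart_bracket)
qed

lemma std_bracket_stereoN:
  "fval (std_bracket f g) (stereoN w)
     = 1/4 * (1 + (cmod w)\<^sup>2)\<^sup>2 * jac (fval f \<circ> stereoN) (fval g \<circ> stereoN) w"
  by (simp add: std_bracket.rep_eq inj_stereoN inv_f_f chart_bracket_def)

lemma std_bracket_stereoS:
  "fval (std_bracket f g) (stereoS u)
     = 1/4 * (1 + (cmod u)\<^sup>2)\<^sup>2 * jac (fval f \<circ> stereoS) (fval g \<circ> stereoS) u"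
proof (cases "u = 0")
  case True
  then show ?thesis
    using stereoS_0_notin by (auto simp: std_bracket.rep_eq inj_stereoS inv_f_f chart_bracket_def)
next
  case False
  have f: "smooth (fval h \<circ> stereoN)" for h using fval by blast
  show ?thesis
    using chart_bracket_transition[OF f f False, of f g]
    unfolding stereoN_inverse[OF False, symmetric] std_bracket_stereoN by (simp add: chart_bracket_def)
qed

definition std_poisson :: "cinf list \<Rightarrow> cinf" where
  "std_poisson fs = (case fs of [f, g] \<Rightarrow> std_bracket f g | _ \<Rightarrow> 0)"

definition necklace :: "real \<Rightarrow> cinf list \<Rightarrow> cinf" where
  "necklace c fs = (of_real c - coord_fun 3) * std_poisson fs"

text \<open>The coordinate expression \<open>1/4 (1 + x\<^sup>2 + y\<^sup>2) ((c + 1) (x\<^sup>2 + y\<^sup>2) + c - 1) \<partial>\<^sub>x \<and> \<partial>\<^sub>y\<close>:\<close>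

lemma necklace_stereoN:
  "fval (necklace c [f, g]) (stereoN w) =
     1/4 * (1 + (cmod w)\<^sup>2) * ((c + 1) * (cmod w)\<^sup>2 + c - 1)
       * jac (fval f \<circ> stereoN) (fval g \<circ> stereoN) w"
proof -
  have "c - (1 - (cmod w)\<^sup>2) / (1 + (cmod w)\<^sup>2)
      = ((c + 1) * (cmod w)\<^sup>2 + c - 1) / (1 + (cmod w)\<^sup>2)"
    by (simp add: field_simps)
  then show ?thesis
    unfolding necklace_def std_poisson_def
    by (simp add: std_bracket_stereoN stereoN_nth power2_eq_square[of "1 + _"])
qed

section \<open>Necklace structures are Poisson\<close>

lemma jac_simps:
  assumes "smooth F" "smooth G" "smooth H"
  shows "jac (\<lambda>w. F w + G w) H w = jac F H w + jac G H w"
    and "jac H (\<lambda>w. F w + G w) w = jac H F w + jac H G w"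
    and "jac (\<lambda>w. F w * G w) H w = F w * jac G H w + G w * jac F H w"
    and "jac H (\<lambda>w. F w * G w) w = F w * jac H G w + G w * jac H F w"
    and "jac (\<lambda>w. a) H w = 0" and "jac H (\<lambda>w. a) w = 0"
proof -
  have *: "(K has_derivative frechet_derivative K (at w)) (at w)" if "smooth K" for K :: "complex \<Rightarrow> real"
    using smooth_differentiable[OF that] frechet_derivative_works by blast
  note [simp] = frechet_derivative_at[OF has_derivative_add[OF *[OF assms(1)] *[OF assms(2)]], symmetric]
    frechet_derivative_at[OF has_derivative_mult[OF *[OF assms(1)] *[OF assms(2)]], symmetric]
  show "jac (\<lambda>w. F w + G w) H w = jac F H w + jac G H w"
    and "jac H (\<lambda>w. F w + G w) w = jac H F w + jac H G w"
    and "jac (\<lambda>w. F w * G w) H w = F w * jac G H w + G w * jac F H w"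
    and "jac H (\<lambda>w. F w * G w) w = F w * jac H G w + G w * jac H F w"
    and "jac (\<lambda>w. a) H w = 0" and "jac H (\<lambda>w. a) w = 0"
    by (simp_all add: jac_def algebra_simps frechet_derivative_at[OF has_derivative_const, symmetric])
qed

lemma jac_skew: "jac F G w = - jac G F w" and jac_self: "jac F F w = 0"
  by (simp_all add: jac_def)

lemma smooth_fval: "smooth (fval f \<circ> stereoN)" "smooth (fval f \<circ> stereoS)"
  using fval[of f] by auto

lemma cinf_stereo_eqI:
  assumes "\<And>w. fval f (stereoN w) = fval g (stereoN w)" "\<And>u. fval f (stereoS u) = fval g (stereoS u)"
  shows "f = g"
proof (rule cinf_eqI)
  show "fval f p = fval g p" for p by (cases p rule: S2_cases) (simp_all add: assms)
qed

lemma fval_comp: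
  "fval (f + g) \<circ> \<phi> = (\<lambda>w. (fval f \<circ> \<phi>) w + (fval g \<circ> \<phi>) w)"
  "fval (f * g) \<circ> \<phi> = (\<lambda>w. (fval f \<circ> \<phi>) w * (fval g \<circ> \<phi>) w)"
  "fval (c *\<^sub>R g) \<circ> \<phi> = (\<lambda>w. c * (fval g \<circ> \<phi>) w)"
  by auto

lemma std_bracket_skew: "std_bracket f g = - std_bracket g f"
  by (rule cinf_stereo_eqI; simp add: std_bracket_stereoN std_bracket_stereoS; subst jac_skew; simp)

lemma std_bracket_self: "std_bracket f f = 0"
  by (rule cinf_stereo_eqI; simp add: std_bracket_stereoN std_bracket_stereoS jac_self)

lemma std_bracket_add: "std_bracket (f + g) h = std_bracket f h + std_bracket g h"
  by (rule cinf_stereo_eqI; simp only: fval_simps std_bracket_stereoN std_bracket_stereoS fval_comp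
      jac_simps(1)[OF smooth_fval(1) smooth_fval(1) smooth_fval(1)] jac_simps(1)[OF smooth_fval(2) smooth_fval(2) smooth_fval(2)];
      simp add: algebra_simps)

lemma std_bracket_mult: "std_bracket (f * g) h = f * std_bracket g h + g * std_bracket f h"
  by (rule cinf_stereo_eqI; simp only: fval_simps std_bracket_stereoN std_bracket_stereoS fval_comp
      jac_simps(3)[OF smooth_fval(1) smooth_fval(1) smooth_fval(1)] jac_simps(3)[OF smooth_fval(2) smooth_fval(2) smooth_fval(2)];
      simp add: algebra_simps)

lemma std_bracket_scaleR: "std_bracket (c *\<^sub>R f) h = c *\<^sub>R std_bracket f h"
  by (rule cinf_stereo_eqI; simp only: fval_simps std_bracket_stereoN std_bracket_stereoS fval_comp
      jac_simps(3)[OF smooth_const smooth_fval(1) smooth_fval(1)] jac_simps(3)[OF smooth_const smooth_fval(2) smooth_fval(2)]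
      jac_simps(5)[OF smooth_fval(1) smooth_fval(1) smooth_fval(1)] jac_simps(5)[OF smooth_fval(2) smooth_fval(2) smooth_fval(2)];
      simp add: algebra_simps)

lemma multiderivation_2I:
  fixes B :: "cinf \<Rightarrow> cinf \<Rightarrow> cinf"
  assumes P: "\<And>f g. P [f, g] = a * std_bracket f g" "\<And>fs. length fs \<noteq> 2 \<Longrightarrow> P fs = 0"
  shows "multiderivation 2 P"
proof -
  have r: "std_bracket h (f + g) = std_bracket h f + std_bracket h g"
    "std_bracket h (f * g) = f * std_bracket h g + g * std_bracket h f"
    "std_bracket h (c *\<^sub>R f) = c *\<^sub>R std_bracket h f" for c f g h
    unfolding std_bracket_skew[of h] by (simp_all add: std_bracket_add std_bracket_mult std_bracket_scaleR)
  have l: "\<exists>f g. fs = [f, g]" if "length fs = 2" for fs :: "cinf list"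
    using that by (auto simp: numeral_2_eq_2 length_Suc_conv)
  show ?thesis
    unfolding multiderivation_def
  proof (intro conjI allI impI)
    show "P fs = 0" if "length fs \<noteq> 2" for fs using P(2)[OF that] .
    fix fs :: "cinf list" and i :: nat assume "length fs = 2 \<and> i < 2"
    then obtain f g where fs: "fs = [f, g]" and i: "i = 0 \<or> i = 1" using l by force
    show "linear (\<lambda>f. P (fs[i := f]))"
      using i by (auto simp: fs P(1) r std_bracket_add std_bracket_scaleR intro!: linearI simp: algebra_simps)
    show "P (fs[i := x * y]) = x * P (fs[i := y]) + y * P (fs[i := x])" for x y
      using i by (auto simp: fs P(1) r std_bracket_mult algebra_simps)
  next
    fix fs :: "cinf list" and i j :: nat assume a: "length fs = 2 \<and> i < j \<and> j < 2 \<and> fs ! i = fs ! j"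
    then obtain f g where fs: "fs = [f, g]" using l by blast
    have ij: "i = 0" "j = 1" using a by auto
    have "fs ! i = fs ! j" using a by blast
    then have "f = g" unfolding ij fs by simp
    then show "P fs = 0" by (simp add: fs P(1) std_bracket_self)
  qed
qed

lemma multiderivation_necklace: "multiderivation 2 (necklace c)"
  by (rule multiderivation_2I[of _ "of_real c - coord_fun 3"])
     (auto simp: necklace_def std_poisson_def split: list.splits)


abbreviation DD :: "(complex \<Rightarrow> real) \<Rightarrow> complex \<Rightarrow> complex \<Rightarrow> real" where
  "DD F v x \<equiv> frechet_derivative F (at x) v"

lemma smooth_has_derivative: "smooth F \<Longrightarrow> (F has_derivative frechet_derivative F (at x)) (at x)"
  using smooth_differentiable frechet_derivative_works by blast

lemma smooth_line_derivative:
  fixes F :: "complex \<Rightarrow> real"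
  assumes "smooth F"
  shows "((\<lambda>t. F (z + t *\<^sub>R v)) has_real_derivative DD F v (z + t *\<^sub>R v)) (at t)"
proof -
  let ?L = "frechet_derivative F (at (z + t *\<^sub>R v))"
  have lin: "linear ?L" using assms by (intro linear_frechet_derivative smooth_differentiable)
  have "((\<lambda>t. z + t *\<^sub>R v) has_derivative (\<lambda>s. s *\<^sub>R v)) (at t)"
    by (auto intro!: derivative_eq_intros)
  from diff_chain_at[OF this smooth_has_derivative[OF assms]]
  have "((\<lambda>t. F (z + t *\<^sub>R v)) has_derivative (\<lambda>s. ?L (s *\<^sub>R v))) (at t)"
    by (simp add: comp_def)
  then show ?thesis
    by (simp add: has_field_derivative_def linear_scale[OF lin] mult.commute[of _ "?L v"] cong: if_cong)
qed

lemma second_difference: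
  fixes F :: "complex \<Rightarrow> real"
  assumes F: "smooth F" and h: "h > 0"
  shows "\<exists>s t. 0 < s \<and> s < h \<and> 0 < t \<and> t < h \<and>
    F (z + h *\<^sub>R v + h *\<^sub>R w) - F (z + h *\<^sub>R v) - F (z + h *\<^sub>R w) + F z
      = h * (h * DD (DD F v) w (z + s *\<^sub>R v + t *\<^sub>R w))"
proof -
  let ?p = "\<lambda>s. F (z + h *\<^sub>R w + s *\<^sub>R v) - F (z + s *\<^sub>R v)"
  have "\<exists>s. 0 < s \<and> s < h \<and> ?p h - ?p 0 =
      (h - 0) * (DD F v (z + h *\<^sub>R w + s *\<^sub>R v) - DD F v (z + s *\<^sub>R v))"
    by (rule MVT2[OF h]) (intro DERIV_diff smooth_line_derivative[OF F])
  then obtain s where s: "0 < s" "s < h" "?p h - ?p 0 =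
      h * (DD F v (z + h *\<^sub>R w + s *\<^sub>R v) - DD F v (z + s *\<^sub>R v))" by auto
  let ?q = "\<lambda>t. DD F v (z + s *\<^sub>R v + t *\<^sub>R w)"
  have "\<exists>t. 0 < t \<and> t < h \<and> ?q h - ?q 0 = (h - 0) * DD (DD F v) w (z + s *\<^sub>R v + t *\<^sub>R w)"
    by (rule MVT2[OF h]) (intro smooth_line_derivative smooth_derivative F)
  then obtain t where t: "0 < t" "t < h" "?q h - ?q 0 = h * DD (DD F v) w (z + s *\<^sub>R v + t *\<^sub>R w)"
    by auto
  have e: "z + h *\<^sub>R w + s *\<^sub>R v = z + s *\<^sub>R v + h *\<^sub>R w" for s by simp
  have "?p h - ?p 0 = h * (?q h - ?q 0)" using s(3) by (simp add: e)
  then have "?p h - ?p 0 = h * (h * DD (DD F v) w (z + s *\<^sub>R v + t *\<^sub>R w))" unfolding t(3) .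
  then show ?thesis using s(1,2) t(1,2) unfolding e by (intro exI[of _ s] exI[of _ t]) simp
qed

lemma mixed_derivatives:
  fixes F :: "complex \<Rightarrow> real"
  assumes F: "smooth F"
  shows "DD (DD F v) w z = DD (DD F w) v z"
proof -
  define h where "h n = inverse (real (Suc n))" for n
  have h0: "h n > 0" for n by (simp add: h_def)
  have hlim: "h \<longlonglongrightarrow> 0" unfolding h_def by (rule LIMSEQ_inverse_real_of_nat)
  have c: "isCont (DD (DD F a) b) z" for a b
    using F by (intro differentiable_imp_continuous_within smooth_differentiable smooth_derivative)
  have lim: "(\<lambda>n. DD (DD F a) b (z + s n *\<^sub>R a + t n *\<^sub>R b)) \<longlonglongrightarrow> DD (DD F a) b z"
    if "\<And>n. 0 < s n \<and> s n < h n \<and> 0 < t n \<and> t n < h n" for a b s t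
  proof -
    have "s \<longlonglongrightarrow> 0" "t \<longlonglongrightarrow> 0"
      using that by (auto intro!: tendsto_sandwich[OF _ _ tendsto_const hlim] always_eventually less_imp_le)
    then have "(\<lambda>n. z + s n *\<^sub>R a + t n *\<^sub>R b) \<longlonglongrightarrow> z + 0 *\<^sub>R a + 0 *\<^sub>R b"
      by (intro tendsto_intros)
    then show ?thesis using isCont_tendsto_compose[OF c] by simp
  qed
  have ch: "\<exists>s t. \<forall>n. Q n (s n) (t n)" if "\<And>n. \<exists>s t. Q n s t"
    for Q :: "nat \<Rightarrow> real \<Rightarrow> real \<Rightarrow> bool"
    using that by metis
  have "\<exists>s t. \<forall>n. 0 < s n \<and> s n < h n \<and> 0 < t n \<and> t n < h n \<and>
    F (z + h n *\<^sub>R v + h n *\<^sub>R w) - F (z + h n *\<^sub>R v) - F (z + h n *\<^sub>R w) + F z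
      = h n * (h n * DD (DD F v) w (z + s n *\<^sub>R v + t n *\<^sub>R w))"
    by (rule ch) (rule second_difference[OF F h0])
  then obtain s t where st: "\<forall>n. 0 < s n \<and> s n < h n \<and> 0 < t n \<and> t n < h n \<and>
    F (z + h n *\<^sub>R v + h n *\<^sub>R w) - F (z + h n *\<^sub>R v) - F (z + h n *\<^sub>R w) + F z
      = h n * (h n * DD (DD F v) w (z + s n *\<^sub>R v + t n *\<^sub>R w))"
    by (elim exE)
  have "\<exists>s' t'. \<forall>n. 0 < s' n \<and> s' n < h n \<and> 0 < t' n \<and> t' n < h n \<and>
    F (z + h n *\<^sub>R w + h n *\<^sub>R v) - F (z + h n *\<^sub>R w) - F (z + h n *\<^sub>R v) + F z
      = h n * (h n * DD (DD F w) v (z + s' n *\<^sub>R w + t' n *\<^sub>R v))"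
    by (rule ch) (rule second_difference[OF F h0])
  then obtain s' t' where st': "\<forall>n. 0 < s' n \<and> s' n < h n \<and> 0 < t' n \<and> t' n < h n \<and>
    F (z + h n *\<^sub>R w + h n *\<^sub>R v) - F (z + h n *\<^sub>R w) - F (z + h n *\<^sub>R v) + F z
      = h n * (h n * DD (DD F w) v (z + s' n *\<^sub>R w + t' n *\<^sub>R v))"
    by (elim exE)
  have "DD (DD F v) w (z + s n *\<^sub>R v + t n *\<^sub>R w) = DD (DD F w) v (z + s' n *\<^sub>R w + t' n *\<^sub>R v)" for n
  proof -
    have e: "z + h n *\<^sub>R w + h n *\<^sub>R v = z + h n *\<^sub>R v + h n *\<^sub>R w" by (simp only: add_ac)
    have "h n * (h n * DD (DD F v) w (z + s n *\<^sub>R v + t n *\<^sub>R w))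
       = h n * (h n * DD (DD F w) v (z + s' n *\<^sub>R w + t' n *\<^sub>R v))"
      using spec[OF st, of n] spec[OF st', of n] unfolding e by linarith
    then show ?thesis using h0[of n] by simp
  qed
  then have e: "(\<lambda>n. DD (DD F v) w (z + s n *\<^sub>R v + t n *\<^sub>R w))
     = (\<lambda>n. DD (DD F w) v (z + s' n *\<^sub>R w + t' n *\<^sub>R v))" by (rule ext)
  have "(\<lambda>n. DD (DD F v) w (z + s n *\<^sub>R v + t n *\<^sub>R w)) \<longlonglongrightarrow> DD (DD F v) w z"
    by (rule lim) (use st in blast)
  moreover have "(\<lambda>n. DD (DD F w) v (z + s' n *\<^sub>R w + t' n *\<^sub>R v)) \<longlonglongrightarrow> DD (DD F w) v z"
    by (rule lim) (use st' in blast)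
  ultimately show ?thesis unfolding e by (rule LIMSEQ_unique)
qed

lemma jac_jacobi:
  assumes F: "smooth F" and G: "smooth G" and H: "smooth H"
  shows "jac (jac F G) H z + jac (jac G H) F z + jac (jac H F) G z = 0"
proof -
  have D: "DD (jac F G) v z = DD (DD F 1) v z * DD G \<i> z + DD F 1 z * DD (DD G \<i>) v z
      - (DD (DD F \<i>) v z * DD G 1 z + DD F \<i> z * DD (DD G 1) v z)"
    if F: "smooth F" and G: "smooth G" for F G v
  proof -
    note d = smooth_has_derivative[OF smooth_derivative]
    have "((\<lambda>w. jac F G w) has_derivative (\<lambda>v. (DD F 1 z * DD (DD G \<i>) v z + DD (DD F 1) v z * DD G \<i> z)
      - (DD F \<i> z * DD (DD G 1) v z + DD (DD F \<i>) v z * DD G 1 z))) (at z)"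
      unfolding jac_def by (intro has_derivative_diff has_derivative_mult d F G)
    from frechet_derivative_at[OF this, symmetric] show ?thesis by simp
  qed
  note m = mixed_derivatives[where v=\<i> and w=1 and z=z]
  show ?thesis
    unfolding jac_def[of "jac _ _"] D[OF F G] D[OF G H] D[OF H F] m[OF F] m[OF G] m[OF H]
    by (simp add: algebra_simps)
qed

lemma jac_pluecker: "jac F G z * jac K H z + jac G H z * jac K F z + jac H F z * jac K G z = 0"
  by (simp add: jac_def algebra_simps)

lemma chart_jacobi:
  assumes \<phi>: "\<And>f. smooth (fval f \<circ> \<phi>)"
    and br: "\<And>f g w. fval (std_bracket f g) (\<phi> w)
      = 1/4 * (1 + (cmod w)\<^sup>2)\<^sup>2 * jac (fval f \<circ> \<phi>) (fval g \<circ> \<phi>) w"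
  shows "fval (std_bracket (std_bracket f g) h + std_bracket (std_bracket g h) f
        + std_bracket (std_bracket h f) g) (\<phi> w) = 0"
    and "fval (std_bracket f g * std_bracket k h + std_bracket g h * std_bracket k f
        + std_bracket h f * std_bracket k g) (\<phi> w) = 0"
proof -
  let ?r = "\<lambda>w. 1/4 * (1 + (cmod w)\<^sup>2)\<^sup>2"
  let ?c = "\<lambda>f. fval f \<circ> \<phi>"
  have r: "smooth ?r" by (intro smooth_mult smooth_power smooth_add smooth_const smooth_cmod2)
  have b: "?c (std_bracket f g) = (\<lambda>w. ?r w * jac (?c f) (?c g) w)" for f g
    by (simp add: fun_eq_iff br)
  have b2: "fval (std_bracket (std_bracket f g) h) (\<phi> w)
     = ?r w * (?r w * jac (jac (?c f) (?c g)) (?c h) w + jac (?c f) (?c g) w * jac ?r (?c h) w)" for f g h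
    unfolding br[of "std_bracket _ _"] b by (subst jac_simps(3)[OF r smooth_jac[OF \<phi> \<phi>] \<phi>]) simp
  have j: "jac (jac (?c f) (?c g)) (?c h) w + jac (jac (?c g) (?c h)) (?c f) w
      + jac (jac (?c h) (?c f)) (?c g) w = 0" by (rule jac_jacobi[OF \<phi> \<phi> \<phi>])
  have p: "jac (?c f) (?c g) w * jac K (?c h) w + jac (?c g) (?c h) w * jac K (?c f) w
      + jac (?c h) (?c f) w * jac K (?c g) w = 0" for K by (rule jac_pluecker)
  have *: "r * (r * x1 + y1) + r * (r * x2 + y2) + r * (r * x3 + y3)
      = r * (r * (x1 + x2 + x3) + (y1 + y2 + y3))" for r x1 x2 x3 y1 y2 y3 :: real
    by (simp add: algebra_simps)
  have **: "r * x1 * (r * y1) + r * x2 * (r * y2) + r * x3 * (r * y3)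
      = r * r * (x1 * y1 + x2 * y2 + x3 * y3)" for r x1 x2 x3 y1 y2 y3 :: real
    by (simp add: algebra_simps)
  have "fval (std_bracket (std_bracket f g) h + std_bracket (std_bracket g h) f
        + std_bracket (std_bracket h f) g) (\<phi> w)
    = ?r w * (?r w * (jac (jac (?c f) (?c g)) (?c h) w + jac (jac (?c g) (?c h)) (?c f) w
      + jac (jac (?c h) (?c f)) (?c g) w) + (jac (?c f) (?c g) w * jac ?r (?c h) w
      + jac (?c g) (?c h) w * jac ?r (?c f) w + jac (?c h) (?c f) w * jac ?r (?c g) w))"
    unfolding fval_simps b2 by (rule *)
  also have "\<dots> = 0" unfolding j p by simp
  finally show "fval (std_bracket (std_bracket f g) h + std_bracket (std_bracket g h) f
        + std_bracket (std_bracket h f) g) (\<phi> w) = 0" .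
  have "fval (std_bracket f g * std_bracket k h + std_bracket g h * std_bracket k f
        + std_bracket h f * std_bracket k g) (\<phi> w)
     = ?r w * ?r w * (jac (?c f) (?c g) w * jac (?c k) (?c h) w
      + jac (?c g) (?c h) w * jac (?c k) (?c f) w + jac (?c h) (?c f) w * jac (?c k) (?c g) w)"
    unfolding fval_simps br by (rule **)
  also have "\<dots> = 0" unfolding p by simp
  finally show "fval (std_bracket f g * std_bracket k h + std_bracket g h * std_bracket k f
        + std_bracket h f * std_bracket k g) (\<phi> w) = 0" .
qed

lemma std_bracket_jacobi:
  "std_bracket (std_bracket f g) h + std_bracket (std_bracket g h) f + std_bracket (std_bracket h f) g = 0"
  by (rule cinf_stereo_eqI)
    (simp_all only: chart_jacobi(1)[OF smooth_fval(1) std_bracket_stereoN]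
      chart_jacobi(1)[OF smooth_fval(2) std_bracket_stereoS] fval_simps(1))

lemma std_bracket_pluecker:
  "std_bracket f g * std_bracket k h + std_bracket g h * std_bracket k f + std_bracket h f * std_bracket k g = 0"
  by (rule cinf_stereo_eqI)
    (simp_all only: chart_jacobi(2)[OF smooth_fval(1) std_bracket_stereoN]
      chart_jacobi(2)[OF smooth_fval(2) std_bracket_stereoS] fval_simps(1))

lemma shuffle_perms_2_1:
  "shuffle_perms 2 1 =
     {id, Transposition.transpose 1 2, Transposition.transpose 0 1 \<circ> Transposition.transpose 1 2}"
  (is "_ = {id, ?s, ?t \<circ> ?s}")
proof -
  have l3: "{..<2 + 1} = {0, 1, 2::nat}" by auto
  have s: "?s permutes {0, 1, 2::nat}" and t: "?t permutes {0, 1, 2::nat}"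
    by (rule permutes_swap_id; simp)+
  have ts: "?t \<circ> ?s permutes {0, 1, 2::nat}" by (rule permutes_compose[OF s t])
  have vs: "?s 0 = 0" "?s 1 = 2" "?s 2 = (1::nat)" by (simp_all add: Transposition.transpose_def)
  have vt: "(?t \<circ> ?s) 0 = 1" "(?t \<circ> ?s) 1 = 2" "(?t \<circ> ?s) 2 = (0::nat)"
    by (simp_all add: Transposition.transpose_def)
  have I: "\<sigma> \<in> shuffle_perms 2 1" if "\<sigma> permutes {0, 1, 2}" "\<sigma> 0 < \<sigma> 1" for \<sigma>
  proof -
    have "strict_mono_on {..<2} \<sigma>"
    proof (rule strict_mono_onI)
      fix r s :: nat assume "r \<in> {..<2}" "s \<in> {..<2}" "r < s"
      then have "r = 0" "s = 1" by auto
      then show "\<sigma> r < \<sigma> s" using that by simp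
    qed
    moreover have "strict_mono_on {2..<2 + 1} \<sigma>" by (rule strict_mono_onI) auto
    ultimately show ?thesis using that(1) unfolding shuffle_perms_def l3 by blast
  qed
  have "id \<in> shuffle_perms 2 1" by (rule I) (simp_all add: permutes_id)
  moreover have "?s \<in> shuffle_perms 2 1" by (rule I[OF s]) (simp only: vs; simp)
  moreover have "?t \<circ> ?s \<in> shuffle_perms 2 1" by (rule I[OF ts]) (simp only: vt; simp)
  moreover have "\<sigma> = id \<or> \<sigma> = ?s \<or> \<sigma> = ?t \<circ> ?s" if \<sigma>: "\<sigma> \<in> shuffle_perms 2 1" for \<sigma>
  proof -
    have p: "\<sigma> permutes {0, 1, 2}" and "strict_mono_on {..<2} \<sigma>"
      using \<sigma> unfolding shuffle_perms_def l3 by blast+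
    then have lt: "\<sigma> 0 < \<sigma> 1" by (auto intro: strict_mono_onD)
    have im: "\<sigma> x = 0 \<or> \<sigma> x = 1 \<or> \<sigma> x = 2" if "x \<in> {0, 1, 2}" for x
      using permutes_in_image[OF p, of x] that by blast
    have ne: "\<sigma> 0 \<noteq> \<sigma> 2" "\<sigma> 1 \<noteq> \<sigma> 2"
      using inj_eq[OF permutes_inj[OF p], of 0 2] inj_eq[OF permutes_inj[OF p], of 1 2] by simp_all
    have eqI: "\<sigma> = \<tau>" if \<tau>: "\<tau> permutes {0, 1, 2}" and eq: "\<sigma> 0 = \<tau> 0" "\<sigma> 1 = \<tau> 1" "\<sigma> 2 = \<tau> 2" for \<tau>
    proof
      fix x show "\<sigma> x = \<tau> x"
      proof (cases "x \<in> {0, 1, 2}")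
        case True then show ?thesis using eq by blast
      next
        case False then show ?thesis using permutes_not_in[OF p False] permutes_not_in[OF \<tau> False] by simp
      qed
    qed
    have "\<sigma> 0 = 0 \<and> \<sigma> 1 = 1 \<and> \<sigma> 2 = 2 \<or> \<sigma> 0 = 0 \<and> \<sigma> 1 = 2 \<and> \<sigma> 2 = 1
        \<or> \<sigma> 0 = 1 \<and> \<sigma> 1 = 2 \<and> \<sigma> 2 = 0"
      using im[of 0] im[of 1] im[of 2] lt ne by (simp del: One_nat_def) linarith
    then show ?thesis
      using eqI[OF permutes_id] eqI[OF s] eqI[OF ts] unfolding vs vt id_apply by blast
  qed
  ultimately show ?thesis by blast
qed

lemma insertion_2_2:
  "insertion 2 2 P Q [f, g, h] = P [Q [f, g], h] - P [Q [f, h], g] + P [Q [g, h], f]"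
proof -
  let ?s = "Transposition.transpose 1 (2::nat)" and ?t = "Transposition.transpose 0 (1::nat)"
  let ?T = "\<lambda>\<sigma>. of_int (sign \<sigma>) *
     P (Q (map (\<lambda>i. [f, g, h] ! \<sigma> i) [0..<2]) # map (\<lambda>i. [f, g, h] ! \<sigma> i) [2..<2 + (2 - 1)])"
  have u: "[0..<2] = [0, 1]" "[2..<2 + (2 - 1)] = [2::nat]" by (simp_all add: upt_rec)
  have p: "permutation ?s" "permutation ?t" by (rule permutation_swap_id)+
  have sg: "sign ?s = -1" "sign (?t \<circ> ?s) = 1"
    unfolding sign_compose[OF p(2) p(1)] by (simp_all add: sign_swap_id)
  have vs: "?s 0 = 0" "?s 1 = 2" "?s 2 = 1" by (simp_all add: Transposition.transpose_def)
  have vt: "(?t \<circ> ?s) 0 = 1" "(?t \<circ> ?s) 1 = 2" "(?t \<circ> ?s) 2 = 0"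
    by (simp_all add: Transposition.transpose_def)
  have ne: "id \<noteq> ?s" "id \<noteq> ?t \<circ> ?s" "?s \<noteq> ?t \<circ> ?s"
    using vs(2) vt(1) vs(1) by (metis id_apply zero_neq_one one_neq_zero num.distinct(1) numeral_eq_one_iff)+
  have "insertion 2 2 P Q [f, g, h] = ?T id + (?T ?s + ?T (?t \<circ> ?s))"
    unfolding insertion_def diff_Suc_1 one_add_one[symmetric] add_diff_cancel_right'
    unfolding one_add_one shuffle_perms_2_1 using ne by simp
  also have "?T id = P [Q [f, g], h]" unfolding u by (simp add: sign_id)
  also have "?T ?s = - P [Q [f, h], g]" unfolding u list.map vs sg by simp
  also have "?T (?t \<circ> ?s) = P [Q [g, h], f]" unfolding u list.map vt sg by simp
  finally show ?thesis by simp
qed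

lemma schouten_necklace: "schouten 2 2 (necklace c) (necklace c') = (\<lambda>_. 0)"
proof
  fix fs
  show "schouten 2 2 (necklace c) (necklace c') fs = 0"
  proof (cases "length fs = 3")
    case True
    then obtain f g h where fs: "fs = [f, g, h]"
      by (auto simp: numeral_3_eq_3 length_Suc_conv)
    have *: "insertion 2 2 (necklace c) (necklace c') [f, g, h] = 0" for c c'
    proof -
      let ?J = std_bracket
      let ?a = "of_real c - coord_fun 3" and ?b = "of_real c' - coord_fun 3"
      have n: "necklace c [x, y] = (of_real c - coord_fun 3) * ?J x y" for c x y
        by (simp add: necklace_def std_poisson_def)
      have m: "?J (- x) y = - ?J x y" for x y using std_bracket_scaleR[of "-1" x y] by simp
      have r: "a * (b * x1 + y1 * z1) - a * (b * - x3 + - y3 * z3) + a * (b * x2 + y2 * z2)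
        = a * b * (x1 + x2 + x3) + a * (y1 * z1 + y2 * z2 + y3 * z3)"
        for a b x1 x2 x3 y1 y2 y3 z1 z2 z3 :: cinf
        by (simp add: algebra_simps)
      have "insertion 2 2 (necklace c) (necklace c') [f, g, h]
        = ?a * ?b * (?J (?J f g) h + ?J (?J g h) f + ?J (?J h f) g)
        + ?a * (?J f g * ?J ?b h + ?J g h * ?J ?b f + ?J h f * ?J ?b g)"
        unfolding insertion_2_2 n std_bracket_mult
        unfolding std_bracket_skew[of f h] m by (rule r)
      then show ?thesis by (simp only: std_bracket_jacobi std_bracket_pluecker) simp
    qed
    show ?thesis by (simp add: schouten_def fs *)
  qed (simp add: schouten_def)
qed

lemma poisson_structure_necklace: "poisson_structure (necklace c)"
  by (simp add: poisson_structure_def multiderivation_necklace schouten_necklace)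

end

theory Submission
  imports Defs "HOL-Real_Asymp.Real_Asymp"
begin

text \<open>Write \<open>h = c - x\<^sub>3\<close>, so that \<open>\<pi>\<^sub>c = h \<pi>\<close> and \<open>\<pi>\<^sub>c\<^sub>' - \<pi>\<^sub>c = (c' - c) \<pi>\<close>. For a vector field \<open>V\<close>
  the coboundary \<open>[\<pi>\<^sub>c, V]\<close> is \<open>(h div V - V(h)) \<pi>\<close> with the divergence taken for the symplectic
  area. The claim is thus that \<open>h div V - V(h) = k\<close> has no solution for a constant \<open>k \<noteq> 0\<close>. Where
  \<open>h \<noteq> 0\<close> this equation reads \<open>div (V / h) = k / h\<^sup>2\<close>, so the divergence theorem on each of the two
  caps bounded by the circle \<open>h = 0\<close> determines the mean of \<open>a = V(x\<^sub>3)\<close> over every circle of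
  latitude: since \<open>a\<close> vanishes at the poles, that mean is \<open>k - k h / (c - 1)\<close> on
  the northern cap and \<open>k - k h / (c + 1)\<close> on the southern one. A smooth \<open>V\<close> needs both expressions
  to have the same slope at \<open>h = 0\<close>, and as \<open>c - 1 \<noteq> c + 1\<close> this forces \<open>k = 0\<close>. The hypothesis
  \<open>\<bar>c\<bar> < 1\<close> enters because it puts the circle \<open>h = 0\<close> strictly between the poles. Geometrically,
  the obstruction is the regularized symplectic volume of \<open>\<pi>\<^sub>c\<close>, whose first variation vanishes on
  coboundaries but not in the direction of \<open>\<pi>\<close>.

  The vector field is given only as a derivation of the algebra of smooth functions, so \<open>div V\<close> is
  first expressed by brackets of globally defined functions (\<open>coboundary_cylindrical\<close>): multiplied
  by \<open>x\<^sub>1\<^sup>2 + x\<^sub>2\<^sup>2\<close>, it is a derivative of \<open>a\<close> along the meridians plus a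
  derivative along the circles of latitude. In the coordinate \<open>w = e\<^sup>s\<^sup>+\<^sup>i\<^sup>t\<close> the integral over \<open>t\<close> removes the
  second term and leaves, for the integral \<open>M(s)\<close> of \<open>a\<close>, the equation \<open>h M' = h' (M - 2\<pi>k)\<close> on the
  whole line, with \<open>M \<rightarrow> 0\<close> at both ends. Its solutions are \<open>M = 2\<pi>k + C h\<close> with a constant for each
  sign of \<open>h\<close>, and \<open>singular_ode_limits\<close> is the comparison of slopes described above.\<close>

section \<open>Coboundaries of vector fields\<close>

text \<open>A permutation that preserves the order of all its arguments cannot lower any of them.\<close>

lemma shuffle_perms_0_right: "shuffle_perms q 0 = {id}"
proof -
  have "\<sigma> = id" if p: "\<sigma> permutes {..<q}" and m: "strict_mono_on {..<q} \<sigma>" for \<sigma>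
  proof (rule permutes_natset_ge[OF p], rule ballI)
    fix i assume "i \<in> {..<q}"
    then show "i \<le> \<sigma> i"
    proof (induction i)
      case (Suc i)
      then have "\<sigma> i < \<sigma> (Suc i)" by (intro strict_mono_onD[OF m]) auto
      with Suc show ?case by simp
    qed simp
  qed
  then show ?thesis
    by (auto simp: shuffle_perms_def permutes_id strict_mono_on_def)
qed

lemma shuffle_perms_1_1: "shuffle_perms 1 1 = {id, Transposition.transpose 0 1}"
proof -
  have l2: "{..<1 + 1} = {0, 1::nat}" by auto
  have vac: "strict_mono_on {..<1} \<sigma>" "strict_mono_on {1..<1 + 1} \<sigma>" for \<sigma> :: "nat \<Rightarrow> nat"
    by (auto intro: strict_mono_onI)
  show ?thesis
    unfolding shuffle_perms_def l2 permutes_doubleton_iff using vac by auto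
qed

text \<open>For a biderivation \<open>P\<close> this is the negative of the Lie derivative of \<open>P\<close> along \<open>R\<close>.\<close>

lemma poisson_d_vector_field:
  "poisson_d P 1 R [f, g] = P [R [f], g] - P [R [g], f] - R [P [f, g]]"
proof -
  let ?t = "Transposition.transpose 0 (1::nat)"
  have ne: "id \<noteq> ?t" by (metis id_apply transpose_apply_first zero_neq_one)
  have "insertion 2 1 P R [f, g] = P [R [f], g] - P [R [g], f]"
    unfolding insertion_def one_add_one[symmetric] add_diff_cancel_right' shuffle_perms_1_1
    using ne by (simp add: sign_id sign_swap_id upt_rec)
  moreover have "insertion 1 2 R P [f, g] = R [P [f, g]]"
    by (simp add: insertion_def shuffle_perms_0_right sign_id upt_rec)
  ultimately show ?thesis by (simp add: poisson_d_def schouten_def)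
qed

section \<open>The bracket in the stereographic chart\<close>

abbreviation chartN :: "cinf \<Rightarrow> complex \<Rightarrow> real" where
  "chartN f \<equiv> fval f \<circ> stereoN"

lemma smooth_isCont: "smooth F \<Longrightarrow> isCont F x"
  by (intro differentiable_imp_continuous_within smooth_differentiable)

lemma chartN_at_infinity: "(chartN f \<longlongrightarrow> fval f (stereoS 0)) at_infinity"
proof -
  have "isCont (fval f \<circ> stereoS) 0" by (rule smooth_isCont[OF smooth_fval(2)])
  from isCont_tendsto_compose[OF this tendsto_inverse_0]
  have "((\<lambda>w. (fval f \<circ> stereoS) (inverse w)) \<longlongrightarrow> fval f (stereoS 0)) at_infinity" by simp
  moreover have "\<forall>\<^sub>F w in at_infinity. (fval f \<circ> stereoS) (inverse w) = chartN f w"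
  proof (rule eventually_mono)
    show "\<forall>\<^sub>F w in at_infinity. w \<noteq> (0::complex)" by (rule eventually_not_equal_at_infinity)
    show "(fval f \<circ> stereoS) (inverse w) = chartN f w" if "w \<noteq> 0" for w
      using stereoN_inverse[of "inverse w"] that by simp
  qed
  ultimately show ?thesis by (rule Lim_transform_eventually)
qed

text \<open>The chart misses only the point \<open>stereoS 0\<close>, where values are limits by the previous lemma.\<close>

lemma cinf_eq_stereoN:
  assumes "\<And>w. fval f (stereoN w) = fval g (stereoN w)"
  shows "f = g"
proof -
  have "chartN f = chartN g" using assms by (simp add: fun_eq_iff)
  then have "fval f (stereoS 0) = fval g (stereoS 0)"
    using tendsto_unique[OF trivial_limit_at_infinity chartN_at_infinity[of f]] chartN_at_infinity[of g] by simp
  then show ?thesis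
    by (intro cinf_eqI) (metis S2_cases assms)
qed

lemma smooth_derivative_components:
  assumes "smooth (F :: complex \<Rightarrow> real)"
  shows "DD F v w = Re v * DD F 1 w + Im v * DD F \<i> w"
proof -
  have lin: "linear (frechet_derivative F (at w))"
    using assms by (intro linear_frechet_derivative smooth_differentiable)
  have "v = Re v *\<^sub>R 1 + Im v *\<^sub>R \<i>" by (simp add: complex_eq_iff)
  then have "DD F v w = DD F (Re v *\<^sub>R 1 + Im v *\<^sub>R \<i>) w" by simp
  then show ?thesis by (simp add: linear_add[OF lin] linear_scale[OF lin])
qed

lemma DD_coord:
  defines "q \<equiv> \<lambda>w. 1 + (cmod w)\<^sup>2"
  shows "DD (chartN (coord_fun 1)) v w = 2 * Re v / q w - 4 * Re w * (Re w * Re v + Im w * Im v) / (q w)\<^sup>2"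
    and "DD (chartN (coord_fun 2)) v w = 2 * Im v / q w - 4 * Im w * (Re w * Re v + Im w * Im v) / (q w)\<^sup>2"
    and "DD (chartN (coord_fun 3)) v w = - 4 * (Re w * Re v + Im w * Im v) / (q w)\<^sup>2"
proof -
  have q: "(q has_derivative (\<lambda>v. 2 * (Re w * Re v + Im w * Im v))) (at w)"
    unfolding q_def cmod_power2 by (auto intro!: derivative_eq_intros simp: algebra_simps)
  have q0: "q w \<noteq> 0" by (simp add: q_def)
  have c: "chartN (coord_fun 1) = (\<lambda>w. 2 * Re w / q w)" "chartN (coord_fun 2) = (\<lambda>w. 2 * Im w / q w)"
    "chartN (coord_fun 3) = (\<lambda>w. (2 - q w) / q w)"
    by (auto simp: fun_eq_iff stereoN_nth q_def)
  have "(chartN (coord_fun 1) has_derivative (\<lambda>v. 2 * Re v / q w - 4 * Re w * (Re w * Re v + Im w * Im v) / (q w)\<^sup>2)) (at w)"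
    unfolding c
    by (rule has_derivative_eq_rhs, rule derivative_intros q q0 | simp)+
       (use q0 in \<open>auto simp: fun_eq_iff field_simps power2_eq_square\<close>)
  from frechet_derivative_at[OF this, symmetric]
  show "DD (chartN (coord_fun 1)) v w = 2 * Re v / q w - 4 * Re w * (Re w * Re v + Im w * Im v) / (q w)\<^sup>2"
    by simp
  have "(chartN (coord_fun 2) has_derivative (\<lambda>v. 2 * Im v / q w - 4 * Im w * (Re w * Re v + Im w * Im v) / (q w)\<^sup>2)) (at w)"
    unfolding c
    by (rule has_derivative_eq_rhs, rule derivative_intros q q0 | simp)+
       (use q0 in \<open>auto simp: fun_eq_iff field_simps power2_eq_square\<close>)
  from frechet_derivative_at[OF this, symmetric]
  show "DD (chartN (coord_fun 2)) v w = 2 * Im v / q w - 4 * Im w * (Re w * Re v + Im w * Im v) / (q w)\<^sup>2"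
    by simp
  have "(chartN (coord_fun 3) has_derivative (\<lambda>v. - 4 * (Re w * Re v + Im w * Im v) / (q w)\<^sup>2)) (at w)"
    unfolding c
    by (rule has_derivative_eq_rhs, rule derivative_intros q q0 | simp)+
       (use q0 in \<open>auto simp: fun_eq_iff field_simps power2_eq_square\<close>)
  from frechet_derivative_at[OF this, symmetric]
  show "DD (chartN (coord_fun 3)) v w = - 4 * (Re w * Re v + Im w * Im v) / (q w)\<^sup>2"
    by simp
qed

text \<open>The Hamiltonian vector field of the height generates the rotations about the axis, and \<open>\<i> w\<close> is the
  velocity of \<open>w\<close> under the counterclockwise rotation; the sign says that the rotation is clockwise.\<close>

lemma std_bracket_height_stereoN:
  "fval (std_bracket (coord_fun 3) f) (stereoN w) = - DD (chartN f) (\<i> * w) w"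
  unfolding std_bracket_stereoN jac_def smooth_derivative_components[OF smooth_fval(1), where v="\<i> * w" and w=w] DD_coord
  by (simp add: field_simps)

text \<open>Up to the factor \<open>x\<^sub>1\<^sup>2 + x\<^sub>2\<^sup>2\<close> the combination of brackets on the left is \<open>{\<theta>, f}\<close> for the
  longitude \<open>\<theta>\<close>. As \<open>\<theta>\<close> is conjugate to the height, its Hamiltonian vector field
  points along the meridians, which are the rays through \<open>0\<close> in the chart.\<close>

lemma std_bracket_radial_stereoN:
  "fval (coord_fun 2 * std_bracket f (coord_fun 1) - coord_fun 1 * std_bracket f (coord_fun 2)) (stereoN w)
    = - DD (chartN f) w w"
proof -
  let ?x = "Re w" and ?y = "Im w"
  define q where "q = 1 + (cmod w)\<^sup>2"
  define a b where "a = DD (chartN f) 1 w" and "b = DD (chartN f) \<i> w"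
  have q: "q = 1 + ?x\<^sup>2 + ?y\<^sup>2" by (simp add: q_def cmod_power2)
  have q0: "q \<noteq> 0" by (simp add: q_def)
  have J: "fval (std_bracket f (coord_fun 1)) (stereoN w) = b * ?x\<^sup>2 - a * ?x * ?y - b * q / 2"
    "fval (std_bracket f (coord_fun 2)) (stereoN w) = a * q / 2 - a * ?y\<^sup>2 + b * ?x * ?y"
    unfolding std_bracket_stereoN jac_def DD_coord a_def[symmetric] b_def[symmetric] q_def[symmetric]
    using q0 by (simp_all add: field_simps power2_eq_square)
  have "2 * ?y / q * (b * ?x\<^sup>2 - a * ?x * ?y - b * q / 2)
      - 2 * ?x / q * (a * q / 2 - a * ?y\<^sup>2 + b * ?x * ?y) = - (?x * a + ?y * b)"
    using q0 by (simp add: field_simps power2_eq_square)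
  then have "fval (coord_fun 2 * std_bracket f (coord_fun 1) - coord_fun 1 * std_bracket f (coord_fun 2)) (stereoN w)
    = - (?x * a + ?y * b)"
    unfolding fval_simps J stereoN_nth q_def[symmetric] .
  then show ?thesis
    unfolding smooth_derivative_components[OF smooth_fval(1), where v=w and w=w] a_def b_def .
qed

lemma std_bracket_height_coord:
  "std_bracket (coord_fun 3) (coord_fun 1) = coord_fun 2"
  "std_bracket (coord_fun 3) (coord_fun 2) = - coord_fun 1"
  by (rule cinf_eq_stereoN; simp add: std_bracket_height_stereoN DD_coord stereoN_nth)+

section \<open>A differential equation with a singular point\<close>

text \<open>Away from the zero \<open>s\<^sub>0\<close> of \<open>h\<close> the equation says that \<open>(M - K) / h\<close> is locally constant. The two
  constants agree, because both are the limit \<open>M'(s\<^sub>0) / h'(s\<^sub>0)\<close> of this quotient at \<open>s\<^sub>0\<close>. Its limits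
  at the two ends have the same numerator but denominators of opposite sign.\<close>

lemma singular_ode_limits:
  fixes M M' h h' :: "real \<Rightarrow> real"
  assumes M: "\<And>s. (M has_real_derivative M' s) (at s)"
    and h: "\<And>s. (h has_real_derivative h' s) (at s)"
    and pos: "\<And>s. h' s > 0"
    and ode: "\<And>s. h s * M' s = h' s * (M s - K)"
    and top: "(h \<longlongrightarrow> A) at_top" "A > 0" "(M \<longlongrightarrow> m) at_top"
    and bot: "(h \<longlongrightarrow> B) at_bot" "B < 0" "(M \<longlongrightarrow> m) at_bot"
  shows "m = K"
proof -
  define Q where "Q s = (M s - K) / h s" for s
  have mono: "strict_mono h"
    by (rule strict_monoI, rule DERIV_pos_imp_increasing) (use h pos in blast)+
  have "\<exists>s. h s > 0" using order_tendstoD(1)[OF top(1,2)] eventually_happens by fastforce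
  moreover have "\<exists>s. h s < 0" using order_tendstoD(2)[OF bot(1,2)] eventually_happens by fastforce
  ultimately obtain p n where "h p > 0" "h n < 0" by blast
  moreover have "n \<le> p" using calculation strict_mono_less[OF mono, of p n] by linarith
  moreover have "continuous_on {n..p} h" using h by (meson DERIV_isCont continuous_at_imp_continuous_on)
  ultimately obtain s0 where s0: "h s0 = 0" using IVT'[of h n 0 p] by auto
  have sgn: "s > s0 \<Longrightarrow> h s > 0" "s < s0 \<Longrightarrow> h s < 0" for s
    using strict_monoD[OF mono, of s0 s] strict_monoD[OF mono, of s s0] s0 by auto
  have K: "M s0 = K" using ode[of s0] pos[of s0] s0 by simp
  have Q': "(Q has_real_derivative 0) (at s)" if "s \<noteq> s0" for s
  proof -
    have "h s \<noteq> 0" using sgn[of s] that by force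
    moreover from this have "((\<lambda>s. (M s - K) / h s) has_real_derivative 0) (at s)"
      using ode[of s] by (auto intro!: derivative_eq_intros M h simp: field_simps)
    ultimately show ?thesis unfolding Q_def[abs_def] by simp
  qed
  have Qlim: "(Q \<longlongrightarrow> M' s0 / h' s0) (at s0)"
  proof -
    have "((\<lambda>s. ((M s - M s0) / (s - s0)) / ((h s - h s0) / (s - s0))) \<longlongrightarrow> M' s0 / h' s0) (at s0)"
      using M[of s0] h[of s0] pos[of s0] unfolding has_field_derivative_iff by (intro tendsto_divide) auto
    moreover have "\<forall>\<^sub>F s in at s0. ((M s - M s0) / (s - s0)) / ((h s - h s0) / (s - s0)) = Q s"
      by (rule eventually_mono[OF eventually_neq_at_within[of s0]]) (simp add: Q_def K s0)
    ultimately show ?thesis by (rule Lim_transform_eventually)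
  qed
  have "(m - K) / A = M' s0 / h' s0"
  proof -
    have "\<exists>C. \<forall>s\<in>{s0<..}. Q s = C"
      by (rule has_field_derivative_zero_constant) (auto intro: has_field_derivative_at_within Q')
    then obtain C where C: "\<And>s. s > s0 \<Longrightarrow> Q s = C" by auto
    have "(Q \<longlongrightarrow> (m - K) / A) at_top"
      unfolding Q_def[abs_def] using top by (intro tendsto_intros) auto
    moreover have "(Q \<longlongrightarrow> C) at_top"
      by (rule tendsto_eventually, rule eventually_mono[OF eventually_gt_at_top[of s0]]) (rule C)
    ultimately have "(m - K) / A = C" by (rule tendsto_unique[rotated]) simp
    moreover have "(Q \<longlongrightarrow> M' s0 / h' s0) (at_right s0)"
      using Qlim by (rule filterlim_mono) (auto simp: at_le)
    moreover have "(Q \<longlongrightarrow> C) (at_right s0)"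
      by (rule tendsto_eventually) (auto simp: eventually_at_filter C)
    ultimately show ?thesis using tendsto_unique[of "at_right s0"] by fastforce
  qed
  moreover have "(m - K) / B = M' s0 / h' s0"
  proof -
    have "\<exists>C. \<forall>s\<in>{..<s0}. Q s = C"
      by (rule has_field_derivative_zero_constant) (auto intro: has_field_derivative_at_within Q')
    then obtain C where C: "\<And>s. s < s0 \<Longrightarrow> Q s = C" by auto
    have "(Q \<longlongrightarrow> (m - K) / B) at_bot"
      unfolding Q_def[abs_def] using bot by (intro tendsto_intros) auto
    moreover have "(Q \<longlongrightarrow> C) at_bot"
      by (rule tendsto_eventually, rule eventually_mono[OF eventually_gt_at_bot[of s0]]) (rule C)
    ultimately have "(m - K) / B = C" by (rule tendsto_unique[rotated]) simp
    moreover have "(Q \<longlongrightarrow> M' s0 / h' s0) (at_left s0)"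
      using Qlim by (rule filterlim_mono) (auto simp: at_le)
    moreover have "(Q \<longlongrightarrow> C) (at_left s0)"
      by (rule tendsto_eventually) (auto simp: eventually_at_filter C)
    ultimately show ?thesis using tendsto_unique[of "at_left s0"] by fastforce
  qed
  ultimately have "(m - K) / A = (m - K) / B" by simp
  then have "(m - K) * (A - B) = 0" using top(2) bot(2) by (simp add: field_simps)
  then show ?thesis using top(2) bot(2) by auto
qed

section \<open>Integrals over circles\<close>

abbreviation cexp :: "real \<Rightarrow> real \<Rightarrow> complex" where
  "cexp s t \<equiv> exp (complex_of_real s + \<i> * complex_of_real t)"

lemma DERIV_log_polar:
  assumes "smooth F"
  shows "((\<lambda>s. F (cexp s t)) has_real_derivative DD F (cexp s t) (cexp s t)) (at s)"
    and "((\<lambda>t. F (cexp s t)) has_real_derivative DD F (\<i> * cexp s t) (cexp s t)) (at t)"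
proof -
  have *: "((\<lambda>x. F (\<gamma> x)) has_real_derivative DD F v (\<gamma> x)) (at x)"
    if "(\<gamma> has_vector_derivative v) (at x)" for \<gamma> :: "real \<Rightarrow> complex" and v x
  proof -
    have lin: "linear (frechet_derivative F (at (\<gamma> x)))"
      using assms by (intro linear_frechet_derivative smooth_differentiable)
    from diff_chain_at[OF that[unfolded has_vector_derivative_def] smooth_has_derivative[OF assms]]
    have "((\<lambda>x. F (\<gamma> x)) has_derivative (\<lambda>h. DD F (h *\<^sub>R v) (\<gamma> x))) (at x)" by (simp add: comp_def)
    then show ?thesis
      by (simp add: has_field_derivative_def linear_scale[OF lin] mult.commute[of _ "DD F v _"] cong: if_cong)
  qed
  have "((\<lambda>s. cexp s t) has_vector_derivative cexp s t) (at s)"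
    by (rule has_vector_derivative_real_field) (auto intro!: derivative_eq_intros)
  then show "((\<lambda>s. F (cexp s t)) has_real_derivative DD F (cexp s t) (cexp s t)) (at s)" by (rule *)
  have "((\<lambda>t. cexp s t) has_vector_derivative \<i> * cexp s t) (at t)"
    by (rule has_vector_derivative_real_field) (auto intro!: derivative_eq_intros)
  then show "((\<lambda>t. F (cexp s t)) has_real_derivative DD F (\<i> * cexp s t) (cexp s t)) (at t)" by (rule *)
qed

lemma continuous_on_cexp:
  assumes "smooth F"
  shows "continuous_on A (\<lambda>p. F (cexp (fst p) (snd p)))"
proof -
  have "continuous_on UNIV F" by (intro continuous_at_imp_continuous_on ballI smooth_isCont assms)
  then show ?thesis
    by (rule continuous_on_compose2) (auto intro!: continuous_intros)
qed

lemma continuous_on_DD_log_polar: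
  assumes "smooth F"
  shows "continuous_on A (\<lambda>p. DD F (cexp (fst p) (snd p)) (cexp (fst p) (snd p)))"
  unfolding smooth_derivative_components[OF assms, where v="cexp _ _"]
  by (intro continuous_on_add continuous_on_mult continuous_on_cexp smooth_derivative assms smooth_Re smooth_Im)

lemma continuous_on_circle:
  assumes "\<And>A. continuous_on A (\<lambda>p :: real \<times> real. g (fst p) (snd p))"
  shows "continuous_on A (g s)"
proof -
  have "continuous_on A (\<lambda>t. (s, t))" by (intro continuous_intros)
  from continuous_on_compose2[OF assms[of UNIV] this] show ?thesis by simp
qed

definition circle_integral :: "(complex \<Rightarrow> real) \<Rightarrow> real \<Rightarrow> real" where
  "circle_integral F s = integral {0..2 * pi} (\<lambda>t. F (cexp s t))"

lemma DERIV_circle_integral: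
  assumes "smooth F"
  shows "(circle_integral F has_real_derivative
    integral {0..2 * pi} (\<lambda>t. DD F (cexp s t) (cexp s t))) (at s)"
proof -
  have "((\<lambda>s. integral (cbox 0 (2 * pi)) (\<lambda>t. F (cexp s t))) has_real_derivative
    integral (cbox 0 (2 * pi)) (\<lambda>t. DD F (cexp s t) (cexp s t))) (at s within UNIV)"
  proof (rule leibniz_rule_field_derivative)
    show "(\<lambda>t. F (cexp s t)) integrable_on cbox 0 (2 * pi)" for s
      by (rule integrable_continuous, rule continuous_on_circle[OF continuous_on_cexp[OF assms]])
    show "continuous_on (UNIV \<times> cbox 0 (2 * pi)) (\<lambda>(s, t). DD F (cexp s t) (cexp s t))"
      unfolding case_prod_beta by (rule continuous_on_DD_log_polar[OF assms])
  qed (use DERIV_log_polar(1)[OF assms] in auto)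
  then show ?thesis by (simp add: circle_integral_def[abs_def])
qed

text \<open>The circle closes up, so a derivative along it has mean zero.\<close>

lemma has_integral_angular_derivative:
  assumes "smooth F"
  shows "((\<lambda>t. DD F (\<i> * cexp s t) (cexp s t)) has_integral 0) {0..2 * pi}"
proof -
  have "((\<lambda>t. DD F (\<i> * cexp s t) (cexp s t)) has_integral (F (cexp s (2 * pi)) - F (cexp s 0))) {0..2 * pi}"
    by (rule fundamental_theorem_of_calculus)
       (auto simp: has_real_derivative_iff_has_vector_derivative[symmetric]
         intro!: has_field_derivative_at_within[OF DERIV_log_polar(2)[OF assms]])
  moreover have "cexp s (2 * pi) = cexp s 0" by (simp add: exp_add exp_two_pi_i mult.commute)
  ultimately show ?thesis by simp
qed

text \<open>The limit must be uniform in the angle. At both ends of the line it is, because the modulus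
  \<open>e\<^sup>s\<close> of the point does not depend on the angle.\<close>

lemma circle_integral_tendsto:
  assumes F: "smooth F" and lim: "\<And>e. e > 0 \<Longrightarrow> \<forall>\<^sub>F s in X. \<forall>t. \<bar>F (cexp s t) - l\<bar> < e"
  shows "(circle_integral F \<longlongrightarrow> 2 * pi * l) X"
proof (rule tendstoI)
  fix e :: real assume "e > 0"
  then have "e / (4 * pi) > 0" by simp
  from lim[OF this] show "\<forall>\<^sub>F s in X. dist (circle_integral F s) (2 * pi * l) < e"
  proof (rule eventually_mono)
    fix s assume s: "\<forall>t. \<bar>F (cexp s t) - l\<bar> < e / (4 * pi)"
    have c: "continuous_on {0..2 * pi} (\<lambda>t. F (cexp s t))"
      by (rule continuous_on_circle[OF continuous_on_cexp[OF F]])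
    have "circle_integral F s - 2 * pi * l = integral {0..2 * pi} (\<lambda>t. F (cexp s t) - l)"
      unfolding circle_integral_def
      by (subst integral_diff) (auto intro!: integrable_continuous_real c)
    also have "norm \<dots> \<le> e / (4 * pi) * (2 * pi - 0)"
      by (rule integral_bound) (use s in \<open>auto intro!: continuous_intros c less_imp_le\<close>)
    also have "\<dots> < e" using \<open>e > 0\<close> by (simp add: field_simps)
    finally show "dist (circle_integral F s) (2 * pi * l) < e" by (simp add: dist_norm)
  qed
qed

lemma circle_integral_at_bot:
  assumes F: "smooth F"
  shows "(circle_integral F \<longlongrightarrow> 2 * pi * F 0) at_bot"
proof (rule circle_integral_tendsto[OF F])
  fix e :: real assume "e > 0"
  then obtain d where d: "d > 0" "\<And>z. cmod z < d \<Longrightarrow> \<bar>F z - F 0\<bar> < e"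
    using smooth_isCont[OF F, of 0] unfolding continuous_at_eps_delta dist_norm by force
  have "\<forall>\<^sub>F s in at_bot. exp s < d" by (rule order_tendstoD(2)[OF exp_at_bot d(1)])
  then show "\<forall>\<^sub>F s in at_bot. \<forall>t. \<bar>F (cexp s t) - F 0\<bar> < e"
    by (rule eventually_mono) (auto intro!: d(2))
qed

lemma circle_integral_at_top:
  assumes F: "smooth F" and lim: "(F \<longlongrightarrow> l) at_infinity"
  shows "(circle_integral F \<longlongrightarrow> 2 * pi * l) at_top"
proof (rule circle_integral_tendsto[OF F])
  fix e :: real assume "e > 0"
  then obtain b where b: "\<And>z. b \<le> cmod z \<Longrightarrow> \<bar>F z - l\<bar> < e"
    using tendstoD[OF lim] unfolding eventually_at_infinity dist_norm by auto
  have "\<forall>\<^sub>F s in at_top. b \<le> exp s"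
    using exp_at_top unfolding filterlim_at_top by blast
  then show "\<forall>\<^sub>F s in at_top. \<forall>t. \<bar>F (cexp s t) - l\<bar> < e"
    by (rule eventually_mono) (auto intro!: b)
qed

section \<open>The difference of two necklace structures is not exact\<close>

lemma vector_field_derivation:
  assumes "multiderivation 1 R"
  shows "linear (\<lambda>f. R [f])" and "R [f * g] = f * R [g] + g * R [f]" and "R [of_real c] = 0"
proof -
  have "length [0] = 1 \<and> 0 < (1::nat)" by simp
  with assms have "linear (\<lambda>f. R ([0][0 := f])) \<and> (\<forall>f g. R ([0][0 := f * g]) = f * R ([0][0 := g]) + g * R ([0][0 := f]))"
    unfolding multiderivation_def by blast
  then show l: "linear (\<lambda>f. R [f])" and m: "R [f * g] = f * R [g] + g * R [f]" for f g by simp_all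
  have "R [1] = 0" using m[of 1 1] by simp
  then show "R [of_real c] = 0" unfolding of_real_def using linear_scale[OF l] by simp
qed

text \<open>Applying the derivation to \<open>x\<^sub>1\<^sup>2 + x\<^sub>2\<^sup>2 + x\<^sub>3\<^sup>2 = 1\<close> shows that a vector field is tangent to the
  sphere, and at the poles the tangent plane is horizontal.\<close>

lemma vector_field_height_at_pole:
  assumes R: "multiderivation 1 R" and p: "coords p $ 1 = 0" "coords p $ 2 = 0"
  shows "fval (R [coord_fun 3]) p = 0"
proof -
  have s: "(coords p $ 1)\<^sup>2 + (coords p $ 2)\<^sup>2 + (coords p $ 3)\<^sup>2 = 1" for p
    using coords[of p] by (simp add: norm_vec_def L2_set_def sum_3)
  have "coord_fun 1 * coord_fun 1 + coord_fun 2 * coord_fun 2 + coord_fun 3 * coord_fun 3 = of_real 1"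
    by (rule cinf_eqI) (use s in \<open>simp add: power2_eq_square\<close>)
  then have "R [coord_fun 1 * coord_fun 1 + coord_fun 2 * coord_fun 2 + coord_fun 3 * coord_fun 3] = 0"
    using vector_field_derivation(3)[OF R, of 1] by simp
  then have "fval (R [coord_fun 1 * coord_fun 1 + coord_fun 2 * coord_fun 2 + coord_fun 3 * coord_fun 3]) p = 0"
    by simp
  then have "2 * (coords p $ 3 * fval (R [coord_fun 3]) p) = 0"
    unfolding vector_field_derivation(2)[OF R] linear_add[OF vector_field_derivation(1)[OF R]] fval_simps p
    by simp
  then have "coords p $ 3 * fval (R [coord_fun 3]) p = 0" by simp
  moreover have "coords p $ 3 \<noteq> 0" using s[of p] p by auto
  ultimately show ?thesis by simp
qed

text \<open>This is the coboundary equation for the pair of the height and the longitude, multiplied by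
  \<open>- (x\<^sub>1\<^sup>2 + x\<^sub>2\<^sup>2)\<close> to make it meaningful at the poles. It is obtained as \<open>x\<^sub>2\<close> times the equation for
  \<open>(x\<^sub>3, x\<^sub>1)\<close> minus \<open>x\<^sub>1\<close> times that for \<open>(x\<^sub>3, x\<^sub>2)\<close>. The function \<open>- B\<close> is
  \<open>(x\<^sub>1\<^sup>2 + x\<^sub>2\<^sup>2) V(\<theta>)\<close>, where \<open>\<theta>\<close> is the longitude.\<close>

lemma coboundary_cylindrical:
  assumes R: "multiderivation 1 R"
    and d: "\<And>f g. poisson_d (necklace c) 1 R [f, g] = of_real k * std_bracket f g"
  defines "B \<equiv> coord_fun 2 * R [coord_fun 1] - coord_fun 1 * R [coord_fun 2]"
  shows "(of_real c - coord_fun 3) *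
      (coord_fun 2 * std_bracket (R [coord_fun 3]) (coord_fun 1)
       - coord_fun 1 * std_bracket (R [coord_fun 3]) (coord_fun 2) + std_bracket (coord_fun 3) B)
    + (coord_fun 1 * coord_fun 1 + coord_fun 2 * coord_fun 2) * R [coord_fun 3]
    = of_real k * (coord_fun 1 * coord_fun 1 + coord_fun 2 * coord_fun 2)"
proof -
  let ?x = "coord_fun 1" and ?y = "coord_fun 2" and ?z = "coord_fun 3" and ?h = "of_real c - coord_fun 3"
  let ?J = std_bracket
  note V = vector_field_derivation[OF R] and lin = linear_diff[OF vector_field_derivation(1)[OF R]]
    linear_neg[OF vector_field_derivation(1)[OF R]]
  have N: "necklace c [f, g] = ?h * ?J f g" for f g by (simp add: necklace_def std_poisson_def)
  have Vh: "R [?h] = - R [?z]" using lin(1)[of "of_real c" ?z] V(3) by simp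
  have E: "?h * ?J (R [?z]) g + ?h * ?J ?z (R [g]) + ?J ?z g * R [?z] - ?h * R [?J ?z g]
      = of_real k * ?J ?z g" for g
    using d[of ?z g] unfolding poisson_d_vector_field N V(2) Vh std_bracket_skew[of "R [g]" ?z]
    by (simp add: algebra_simps)
  have Jz: "?J ?z (f * g) = f * ?J ?z g + g * ?J ?z f" "?J ?z (f - g) = ?J ?z f - ?J ?z g" for f g
    unfolding std_bracket_skew[of ?z]
    using std_bracket_add[of f "- g" ?z] std_bracket_scaleR[of "-1" g ?z]
    by (simp_all add: std_bracket_mult)
  have "?h * (?y * ?J (R [?z]) ?x - ?x * ?J (R [?z]) ?y + ?J ?z B) + (?x * ?x + ?y * ?y) * R [?z]
    = ?y * (?h * ?J (R [?z]) ?x + ?h * ?J ?z (R [?x]) + ?J ?z ?x * R [?z] - ?h * R [?J ?z ?x])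
    - ?x * (?h * ?J (R [?z]) ?y + ?h * ?J ?z (R [?y]) + ?J ?z ?y * R [?z] - ?h * R [?J ?z ?y])"
    unfolding B_def Jz std_bracket_height_coord lin(2) by (simp add: algebra_simps)
  also have "\<dots> = of_real k * (?x * ?x + ?y * ?y)"
    unfolding E unfolding std_bracket_height_coord by (simp add: algebra_simps)
  finally show ?thesis .
qed

text \<open>Averaging the cylindrical equation over the circles of latitude gives the hypotheses of
  \<open>singular_ode_limits\<close>. In the coordinate \<open>s = log |w|\<close> the derivative of \<open>h\<close> is exactly the weight
  \<open>x\<^sub>1\<^sup>2 + x\<^sub>2\<^sup>2\<close>.\<close>

lemma necklace_coboundary_zero:
  assumes c: "\<bar>c\<bar> < 1" and R: "multiderivation 1 R"
    and d: "\<And>f g. poisson_d (necklace c) 1 R [f, g] = of_real k * std_bracket f g"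
  shows "k = 0"
proof -
  define B where "B = coord_fun 2 * R [coord_fun 1] - coord_fun 1 * R [coord_fun 2]"
  define F where "F = chartN (R [coord_fun 3])"
  define h where "h s = c - (1 - (exp s)\<^sup>2) / (1 + (exp s)\<^sup>2)" for s :: real
  define h' where "h' s = (2 * exp s / (1 + (exp s)\<^sup>2))\<^sup>2" for s :: real
  have p: "1 + (exp s)\<^sup>2 > 0" "1 + (exp s)\<^sup>2 \<noteq> 0" for s :: real by (auto simp: add_pos_nonneg add_nonneg_eq_0_iff)
  have F: "smooth F" unfolding F_def by (rule smooth_fval)
  \<comment> \<open>In the chart all brackets in the cylindrical equation become derivatives along rays and circles.\<close>
  have pt: "h s * DD F (cexp s t) (cexp s t)
      = h' s * (F (cexp s t) - k) - h s * DD (chartN B) (\<i> * cexp s t) (cexp s t)" for s t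
  proof -
    let ?w = "cexp s t"
    have r: "cmod ?w = exp s" by simp
    have "fval (coord_fun 1 * coord_fun 1 + coord_fun 2 * coord_fun 2) (stereoN ?w)
        = (2 / (1 + (cmod ?w)\<^sup>2))\<^sup>2 * ((Re ?w)\<^sup>2 + (Im ?w)\<^sup>2)"
      unfolding fval_simps stereoN_nth by (simp add: power2_eq_square algebra_simps add_divide_distrib)
    also have "\<dots> = h' s"
      unfolding cmod_power2[symmetric] r h'_def by (simp add: power_divide power_mult_distrib)
    finally have rho: "fval (coord_fun 1 * coord_fun 1 + coord_fun 2 * coord_fun 2) (stereoN ?w) = h' s" .
    have hh: "fval (of_real c - coord_fun 3) (stereoN ?w) = h s"
      unfolding fval_simps fval_of_real stereoN_nth r h_def ..
    have "h s * (- DD F ?w ?w + - DD (chartN B) (\<i> * ?w) ?w) + h' s * F ?w = k * h' s"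
      using arg_cong[OF coboundary_cylindrical[OF R d], of "\<lambda>f. fval f (stereoN ?w)"]
      unfolding B_def[symmetric]
      unfolding fval_simps(3)[of "_ * (_ - _ + _)"] fval_simps(6)[of "of_real c - coord_fun 3"] fval_simps(3)[of "_ - _" "std_bracket _ _"]
        fval_simps(6)[of "_ + _"] fval_simps(6)[of "of_real k"] fval_of_real rho hh std_bracket_radial_stereoN std_bracket_height_stereoN
      by (simp add: F_def)
    then show ?thesis by (simp add: algebra_simps)
  qed
  have "2 * pi * 0 = 2 * pi * k"
  proof (rule singular_ode_limits)
    show "(circle_integral F has_real_derivative integral {0..2 * pi} (\<lambda>t. DD F (cexp s t) (cexp s t))) (at s)" for s
      by (rule DERIV_circle_integral[OF F])
    show "(h has_real_derivative h' s) (at s)" for s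
      unfolding h_def[abs_def] h'_def using p(2)[of s]
      by (auto intro!: derivative_eq_intros simp: field_simps power2_eq_square)
    show "h' s > 0" for s unfolding h'_def using p(1)[of s] by (intro zero_less_power divide_pos_pos) auto
    show "h s * integral {0..2 * pi} (\<lambda>t. DD F (cexp s t) (cexp s t)) = h' s * (circle_integral F s - 2 * pi * k)" for s
    proof -
      have i: "(\<lambda>t. F (cexp s t)) integrable_on {0..2 * pi}"
        by (rule integrable_continuous_real, rule continuous_on_circle[OF continuous_on_cexp[OF F]])
      have ik: "((\<lambda>t. k) has_integral 2 * pi * k) {0..2 * pi}"
        using has_integral_const_real[of k 0 "2 * pi"] by simp
      have "((\<lambda>t. h' s * (F (cexp s t) - k) - h s * DD (chartN B) (\<i> * cexp s t) (cexp s t))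
          has_integral h' s * (circle_integral F s - 2 * pi * k) - h s * 0) {0..2 * pi}"
        unfolding circle_integral_def
        by (intro has_integral_diff has_integral_mult_right integrable_integral[OF i] ik
            has_integral_angular_derivative smooth_fval)
      then have "integral {0..2 * pi} (\<lambda>t. h s * DD F (cexp s t) (cexp s t)) = h' s * (circle_integral F s - 2 * pi * k)"
        unfolding pt by (simp add: integral_unique)
      then show ?thesis by simp
    qed
    show "(h \<longlongrightarrow> c + 1) at_top" unfolding h_def[abs_def] by real_asymp
    show "(h \<longlongrightarrow> c - 1) at_bot" unfolding h_def[abs_def] by real_asymp
    show "c + 1 > 0" "c - 1 < 0" using c by auto
    have "fval (R [coord_fun 3]) (stereoS 0) = 0"
      by (rule vector_field_height_at_pole[OF R]) (simp_all add: stereoS_nth)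
    then show "(circle_integral F \<longlongrightarrow> 2 * pi * 0) at_top"
      using circle_integral_at_top[OF F, of 0] chartN_at_infinity[of "R [coord_fun 3]"] unfolding F_def by simp
    have "F 0 = 0"
      unfolding F_def comp_def by (rule vector_field_height_at_pole[OF R]) (simp_all add: stereoN_nth)
    then show "(circle_integral F \<longlongrightarrow> 2 * pi * 0) at_bot" using circle_integral_at_bot[OF F] by simp
  qed
  then show ?thesis by simp
qed

lemma necklace_diff:
  "(necklace c' - necklace c) [f, g] = of_real (c' - c) * std_bracket f g"
  "length fs \<noteq> 2 \<Longrightarrow> (necklace c' - necklace c) fs = 0"
  by (auto simp: necklace_def std_poisson_def algebra_simps split: list.splits)

text \<open>The bracket of any two necklace structures vanishes, and the differential is linear.\<close>

lemma necklace_diff_cocycle: "necklace c' - necklace c \<in> cocycles (necklace c) 2"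
proof -
  have md: "multiderivation 2 (necklace c' - necklace c)"
    by (rule multiderivation_2I[OF necklace_diff])
  have "poisson_d (necklace c) 2 (necklace c' - necklace c) fs = 0" for fs
  proof (cases "length fs = 3")
    case True
    then obtain f g h where fs: "fs = [f, g, h]"
      by (auto simp: numeral_3_eq_3 length_Suc_conv)
    have sub: "std_bracket (x - y) z = std_bracket x z - std_bracket y z" for x y z
      using std_bracket_add[of x "- y" z] std_bracket_scaleR[of "-1" y z] by simp
    have n: "necklace a [x - y, z] = necklace a [x, z] - necklace a [y, z]" for a x y z
      by (simp add: necklace_def std_poisson_def sub algebra_simps)
    have "poisson_d (necklace c) 2 (necklace c' - necklace c) [f, g, h]
      = schouten 2 2 (necklace c) (necklace c') [f, g, h] - schouten 2 2 (necklace c) (necklace c) [f, g, h]"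
      by (simp add: poisson_d_def schouten_def insertion_2_2 n)
    then show ?thesis by (simp add: fs schouten_necklace)
  qed (simp add: poisson_d_def schouten_def)
  then show ?thesis using md by (simp add: cocycles_def fun_eq_iff)
qed

lemma coboundary_if_class_eq_zero:
  assumes "P \<in> cocycles \<pi> k" "(\<lambda>_. 0) \<in> coboundaries \<pi> k"
    and "cohomology_class \<pi> k P = cohomology_class \<pi> k (\<lambda>_. 0)"
  shows "(\<lambda>_. 0) - P \<in> coboundaries \<pi> k"
proof -
  have "P - P = (\<lambda>_. 0)" by auto
  then have "(P, P) \<in> cohomologous \<pi> k" using assms by (simp add: cohomologous_def)
  then have "P \<in> cohomology_class \<pi> k (\<lambda>_. 0)"
    unfolding assms(3)[symmetric] by (simp add: cohomology_class_def)
  then show ?thesis by (simp add: cohomology_class_def cohomologous_def fun_diff_def)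
qed

lemma necklace_diff_nontrivial:
  assumes c: "\<bar>c\<bar> < 1" and ne: "c \<noteq> c'"
  shows "cohomology_class (necklace c) 2 (necklace c' - necklace c)
    \<in> poisson_cohomology (necklace c) 2 - {cohomology_class (necklace c) 2 (\<lambda>_. 0)}"
proof
  show "cohomology_class (necklace c) 2 (necklace c' - necklace c) \<in> poisson_cohomology (necklace c) 2"
    unfolding cohomology_class_def poisson_cohomology_def by (rule quotientI[OF necklace_diff_cocycle])
  have cob: "coboundaries (necklace c) 2 = poisson_d (necklace c) 1 ` {R. multiderivation 1 R}"
    by (simp add: coboundaries_def numeral_2_eq_2)
  have z: "std_bracket 0 f = 0" for f using std_bracket_scaleR[of 0 0 f] by simp
  have "poisson_d (necklace c) 1 (\<lambda>_. 0) fs = 0" for fs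
  proof (cases "length fs = 2")
    case True
    then obtain f g where "fs = [f, g]" by (auto simp: numeral_2_eq_2 length_Suc_conv)
    then show ?thesis
      by (simp only: poisson_d_vector_field) (simp add: necklace_def std_poisson_def z)
  qed (simp add: poisson_d_def schouten_def)
  then have "(\<lambda>_. 0) = poisson_d (necklace c) 1 (\<lambda>_. 0)" by auto
  moreover have "multiderivation 1 (\<lambda>_ :: cinf list. 0 :: cinf)"
    by (auto simp: multiderivation_def intro!: linearI)
  ultimately have zero: "(\<lambda>_. 0) \<in> coboundaries (necklace c) 2" unfolding cob by blast
  show "cohomology_class (necklace c) 2 (necklace c' - necklace c) \<notin> {cohomology_class (necklace c) 2 (\<lambda>_. 0)}"
  proof
    assume "cohomology_class (necklace c) 2 (necklace c' - necklace c) \<in> {cohomology_class (necklace c) 2 (\<lambda>_. 0)}"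
    then have "(\<lambda>_. 0) - (necklace c' - necklace c) \<in> coboundaries (necklace c) 2"
      by (intro coboundary_if_class_eq_zero necklace_diff_cocycle zero) simp
    then obtain R where R: "multiderivation 1 R"
      and eq: "poisson_d (necklace c) 1 R = (\<lambda>_. 0) - (necklace c' - necklace c)"
      unfolding cob by auto
    have "poisson_d (necklace c) 1 R [f, g] = of_real (c - c') * std_bracket f g" for f g
    proof -
      have "poisson_d (necklace c) 1 R [f, g] = - ((necklace c' - necklace c) [f, g])"
        unfolding eq by simp
      then show ?thesis unfolding necklace_diff by (simp add: algebra_simps)
    qed
    from necklace_coboundary_zero[OF c R this] show False using ne by simp
  qed
qed

theorem corollary4p3p4:
  fixes c c' :: real
  assumes "\<bar>c\<bar> < 1" and "\<bar>c'\<bar> < 1" and "c \<noteq> c'"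
  shows "cohomology_class (necklace c) 2 (necklace c' - necklace c)
           \<in> poisson_cohomology (necklace c) 2 - {cohomology_class (necklace c) 2 (\<lambda>_. 0)}
       \<and> cohomology_class (necklace c') 2 (necklace c - necklace c')
           \<in> poisson_cohomology (necklace c') 2 - {cohomology_class (necklace c') 2 (\<lambda>_. 0)}"
  using necklace_diff_nontrivial[of c c'] necklace_diff_nontrivial[of c' c] assms by simp

end
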